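(* Let $N\ge1$, $0<\sigma<1$ and $1<p\le 1+\frac{2\sigma}{N+2(1-\sigma)}$. Let $u$ be the solution of problem (P) with an admissible datum $f\not\equiv0$, and let $T<\infty$ be its blow-up time. Then there exist constants $0<c_1\le c_2$ such that $c_1(T-t)^{-\frac{\sigma}{p-1}}\le\|u(\cdot,t)\|_{L^\infty(\mathbb R^N)}\le c_2(T-t)^{-\frac{\sigma}{p-1}}$ for all $t<T$ sufficiently close to $T$.
   Context: Notation: for $t>0$, $K_t(x)=(4\pi t)^{-N/2}e^{-|x|^2/(4t)}$, $L(t)=\frac{1}{|\Gamma(-\sigma)|}t^{-1-\sigma}$, $M(x,t)=K_t(x)L(t)$. The operator is $\mathcal M u(x,t)=\int_{-\infty}^t\int_{\mathbb R^N}(u(x,t)-u(z,s))M(x-z,t-s)\,dz\,ds$. Parabolic Hölder space: $v\in C^\beta_p(\Omega)$ iff $v$ bounded and $|v(x,t)-v(z,s)|\le C(|x-z|^2+|t-s|)^{\beta/2}$. Problem (P): $\mathcal M u=u^p$ in $\mathbb R^N\times(0,T)$, $u=f$ in $\mathbb R^N\times(-\infty,0]$. An admissible datum is a nonnegative $f\in C_p^{2\sigma+\varepsilon}(\mathbb R^N\times(-\infty,0])$, some $\varepsilon>0$, with $|\mathcal Mf(x,s)|\le c|s|^{-\gamma}$ for $s\le-1$ uniformly in $x$, for some $\gamma>\sigma$. With $G(x,t)=K_t(x)\frac{t^{\sigma-1}}{\Gamma(\sigma)}\mathds 1_{\{t>0\}}$, the solution is the unique nonnegative function, bounded on $\mathbb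 R^N\times(-\infty,t]$ for $t<T$, with $u=f$ for $t\le0$ and $u(x,t)=\int_{-\infty}^0\int\mathcal Mf(z,s)G(x-z,t-s)dzds+\int_0^t\int u^p(z,s)G(x-z,t-s)dzds$ for $0<t<T$, where $T$ is the maximal existence time. In the stated range of $p$ every such solution blows up in finite time, i.e. $T<\infty$ and $\|u(\cdot,t)\|_\infty\to\infty$ as $t\to T^-$. *)

theory Defs
  imports "HOL-Analysis.Analysis"
begin

definition heatK :: "real \<Rightarrow> real^'n \<Rightarrow> real" where
  "heatK t x = (4 * pi * t) powr (- real CARD('n) / 2) * exp (- (norm x)\<^sup>2 / (4 * t))"

definition Lker :: "real \<Rightarrow> real \<Rightarrow> real" where
  "Lker \<sigma> t = t powr (-1 - \<sigma>) / \<bar>Gamma (- \<sigma>)\<bar>"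

definition Mker :: "real \<Rightarrow> real^'n \<Rightarrow> real \<Rightarrow> real" where
  "Mker \<sigma> x t = heatK t x * Lker \<sigma> t"

definition Gker :: "real \<Rightarrow> real^'n \<Rightarrow> real \<Rightarrow> real" where
  "Gker \<sigma> x t = (if t > 0 then heatK t x * t powr (\<sigma> - 1) / Gamma \<sigma> else 0)"

definition Mop :: "real \<Rightarrow> (real^'n \<Rightarrow> real \<Rightarrow> real) \<Rightarrow> real^'n \<Rightarrow> real \<Rightarrow> real" where
  "Mop \<sigma> u x t = (LINT zs | lborel.
      indicator {zs. snd zs < t} zs *
      ((u x t - u (fst zs) (snd zs)) * Mker \<sigma> (x - fst zs) (t - snd zs)))"

definition hoelder_p :: "real \<Rightarrow> ((real^'n) \<times> real) set \<Rightarrow> (real^'n \<Rightarrow> real \<Rightarrow> real) \<Rightarrow> bool" where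
  "hoelder_p \<beta> \<Omega> v \<longleftrightarrow>
     (\<exists>B. \<forall>(x,t)\<in>\<Omega>. \<bar>v x t\<bar> \<le> B) \<and>
     (\<exists>C. \<forall>(x,t)\<in>\<Omega>. \<forall>(z,s)\<in>\<Omega>.
         \<bar>v x t - v z s\<bar> \<le> C * ((norm (x - z))\<^sup>2 + \<bar>t - s\<bar>) powr (\<beta> / 2))"

definition admissible :: "real \<Rightarrow> (real^'n \<Rightarrow> real \<Rightarrow> real) \<Rightarrow> bool" where
  "admissible \<sigma> f \<longleftrightarrow>
     (\<forall>x t. t \<le> 0 \<longrightarrow> 0 \<le> f x t) \<and>
     (\<exists>\<epsilon>>0. hoelder_p (2 * \<sigma> + \<epsilon>) {(x, t). t \<le> 0} f) \<and>
     (\<exists>c \<gamma>. \<gamma> > \<sigma> \<and> (\<forall>x s. s \<le> -1 \<longrightarrow> \<bar>Mop \<sigma> f x s\<bar> \<le> c * \<bar>s\<bar> powr (- \<gamma>)))"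

definition is_solution :: "real \<Rightarrow> real \<Rightarrow> (real^'n \<Rightarrow> real \<Rightarrow> real) \<Rightarrow> real \<Rightarrow>
    (real^'n \<Rightarrow> real \<Rightarrow> real) \<Rightarrow> bool" where
  "is_solution \<sigma> p f T u \<longleftrightarrow>
     (\<forall>x t. t < T \<longrightarrow> 0 \<le> u x t) \<and>
     (\<forall>t<T. \<exists>B. \<forall>x s. s \<le> t \<longrightarrow> \<bar>u x s\<bar> \<le> B) \<and>
     (\<forall>x t. t \<le> 0 \<longrightarrow> u x t = f x t) \<and>
     (\<forall>x t. 0 < t \<and> t < T \<longrightarrow>
        u x t =
          (LINT zs | lborel. indicator {zs. snd zs \<le> 0} zs *
              (Mop \<sigma> f (fst zs) (snd zs) * Gker \<sigma> (x - fst zs) (t - snd zs)))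
        + (LINT zs | lborel. indicator {zs. 0 < snd zs \<and> snd zs < t} zs *
              ((u (fst zs) (snd zs)) powr p * Gker \<sigma> (x - fst zs) (t - snd zs))))"

definition supnorm :: "(real^'n \<Rightarrow> real \<Rightarrow> real) \<Rightarrow> real \<Rightarrow> real" where
  "supnorm u t = (SUP x. \<bar>u x t\<bar>)"

end

theory Submission
  imports Defs "HOL-Probability.Distributions"
begin

text \<open>
  The datum contributes a bounded term to \<open>u\<close>, so up to a constant \<open>u\<close> is the potential of
  \<open>u\<^sup>p\<close> with kernel \<open>G\<close>.

  Lower rate: by the semigroup property the potential of the past \<open>s < t\<^sub>0\<close> never exceeds
  \<open>sup u(\<cdot>, t\<^sub>0) + C\<close> at later times, so \<open>u\<close> could not double before \<open>T\<close>
  if \<open>sup u(\<cdot>, t\<^sub>0)\<close> were small compared with \<open>(T - t\<^sub>0)\<close> to the power \<open>-\<sigma>/(p - 1)\<close>.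

  Upper rate: let \<open>m = u(x\<^sub>0, t\<^sub>0)\<close> be large and at least half of the past supremum. Almost all
  of this value comes from times before \<open>t\<^sub>0 - a\<close>, where \<open>a\<close> is a multiple of the natural time
  scale \<open>m\<close> to the power \<open>-(p - 1)/\<sigma>\<close>. By a Harnack inequality for \<open>G\<close> the solution then
  stays above a multiple of the fundamental solution after \<open>t\<^sub>0\<close>. If it lived until \<open>t\<^sub>0 + \<rho> a\<close>,
  testing with a Gaussian would bound the weighted integral of \<open>u\<^sup>p\<close> independently of \<open>\<rho>\<close>
  (after scaling), whereas for \<open>p\<close> in the Fujita range the spreading makes it at least of order
  \<open>ln \<rho>\<close>. Hence \<open>T - t\<^sub>0\<close> is at most a constant times \<open>m\<close> to the power \<open>-(p - 1)/\<sigma>\<close>.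
\<close>

section \<open>Heat kernel\<close>

lemma heatK_nonneg [simp]: "0 \<le> heatK t x"
  by (simp add: heatK_def)

lemma heatK_pos: "0 < t \<Longrightarrow> 0 < heatK t x"
  by (simp add: heatK_def)

lemma borel_measurable_heatK [measurable (raw)]:
  assumes [measurable]: "f \<in> borel_measurable M" "g \<in> borel_measurable M"
  shows "(\<lambda>w. heatK (f w) (g w)) \<in> borel_measurable M"
  unfolding heatK_def by measurable

lemma borel_measurable_Gker [measurable (raw)]:
  assumes [measurable]: "f \<in> borel_measurable M" "g \<in> borel_measurable M"
  shows "(\<lambda>w. Gker \<sigma> (f w) (g w)) \<in> borel_measurable M"
  unfolding Gker_def by measurable

text \<open>At time \<open>t\<close> the heat kernel is the density of independent centred normal
  coordinates of variance \<open>2 * t\<close>. This reduces masses and convolutions to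
  one-dimensional facts on normal densities.\<close>

lemma heatK_eq_prod:
  fixes x :: "real^'n"
  assumes "0 < t"
  shows "heatK t x = (\<Prod>b\<in>Basis. normal_density 0 (sqrt (2 * t)) (x \<bullet> b))"
proof -
  have "(\<Prod>b\<in>(Basis::(real^'n) set). normal_density 0 (sqrt (2 * t)) (x \<bullet> b))
     = (\<Prod>b\<in>(Basis::(real^'n) set). (4 * pi * t) powr (-1/2) * exp (- (x \<bullet> b)\<^sup>2 / (4 * t)))"
    using assms by (intro prod.cong) (auto simp: normal_density_def powr_minus powr_half_sqrt field_simps)
  also have "\<dots> = ((4 * pi * t) powr (-1/2)) ^ CARD('n) * exp (\<Sum>b\<in>(Basis::(real^'n) set). - (x \<bullet> b)\<^sup>2 / (4 * t))"
    by (simp add: prod.distrib exp_sum)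
  also have "((4 * pi * t) powr (-1/2)) ^ CARD('n) = (4 * pi * t) powr (- real CARD('n) / 2)"
    using assms by (simp add: powr_powr flip: powr_realpow)
  also have "(\<Sum>b\<in>(Basis::(real^'n) set). - (x \<bullet> b)\<^sup>2 / (4 * t)) = - (norm x)\<^sup>2 / (4 * t)"
    unfolding power2_norm_eq_inner euclidean_inner[of x x]
    by (simp add: sum_negf power2_eq_square flip: sum_divide_distrib)
  finally show ?thesis by (simp add: heatK_def)
qed

text \<open>The integral factors over the coordinates, and in each of them the variances of centred
  normal densities add under convolution.\<close>

lemma nn_integral_heatK_conv:
  fixes x z :: "real^'n"
  assumes "0 < s" "0 < t"
  shows "(\<integral>\<^sup>+y. ennreal (heatK s (x - y)) * ennreal (heatK t (y - z)) \<partial>lborel) = ennreal (heatK (s + t) (x - z))"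
proof -
  let ?n = "\<lambda>t. normal_density 0 (sqrt (2 * t))"
  have 1: "(\<integral>\<^sup>+y. ennreal (?n s (a - y) * ?n t (y - b)) \<partial>lborel) = ennreal (?n (s + t) (a - b))" for a b :: real
  proof -
    have "(\<integral>\<^sup>+y. ennreal (?n s (a - y) * ?n t (y - b)) \<partial>lborel)
      = (\<integral>\<^sup>+y. ennreal (?n s ((a - b) - y) * ?n t y) \<partial>lborel)"
      by (subst nn_integral_real_affine[of _ 1 b]) (auto simp: algebra_simps)
    also have "\<dots> = ennreal (normal_density 0 (sqrt ((sqrt (2 * s))\<^sup>2 + (sqrt (2 * t))\<^sup>2)) (a - b))"
      using assms by (intro fun_cong[OF conv_normal_density_zero_mean]) auto
    finally show ?thesis using assms by (simp add: distrib_left)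
  qed
  have "(\<integral>\<^sup>+y. ennreal (heatK s (x - y)) * ennreal (heatK t (y - z)) \<partial>lborel)
    = (\<integral>\<^sup>+y. (\<Prod>b\<in>Basis. ennreal (?n s (x \<bullet> b - y \<bullet> b) * ?n t (y \<bullet> b - z \<bullet> b))) \<partial>lborel)"
    using assms by (intro nn_integral_cong)
      (simp add: heatK_eq_prod prod_ennreal ennreal_mult[symmetric] prod_nonneg inner_diff_left flip: prod.distrib)
  also have "\<dots> = (\<Prod>b\<in>Basis. \<integral>\<^sup>+y. ennreal (?n s (x \<bullet> b - y) * ?n t (y - z \<bullet> b)) \<partial>lborel)"
    by (subst nn_integral_lborel_prod[where f="\<lambda>b y. ennreal (?n s (x \<bullet> b - y) * ?n t (y - z \<bullet> b))"]) auto
  also have "\<dots> = (\<Prod>b\<in>Basis. ennreal (?n (s + t) (x \<bullet> b - z \<bullet> b)))"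
    by (simp add: 1)
  also have "\<dots> = ennreal (heatK (s + t) (x - z))"
    using assms by (simp add: heatK_eq_prod prod_ennreal inner_diff_left)
  finally show ?thesis .
qed

lemma nn_integral_heatK:
  fixes x :: "real^'n"
  assumes "0 < t"
  shows "(\<integral>\<^sup>+y. ennreal (heatK t (y - x)) \<partial>lborel) = 1"
proof -
  let ?n = "normal_density 0 (sqrt (2 * t))"
  have 1: "(\<integral>\<^sup>+y. ennreal (?n (y - b)) \<partial>lborel) = 1" for b :: real
  proof -
    have "(\<integral>\<^sup>+y. ennreal (?n (y - b)) \<partial>lborel) = (\<integral>\<^sup>+y. ennreal (?n y) \<partial>lborel)"
      by (subst nn_integral_real_affine[of _ 1 b]) (auto simp: algebra_simps)
    also have "\<dots> = 1"
      using assms by (subst nn_integral_eq_integral) auto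
    finally show ?thesis .
  qed
  have "(\<integral>\<^sup>+y. ennreal (heatK t (y - x)) \<partial>lborel)
    = (\<integral>\<^sup>+y. (\<Prod>b\<in>Basis. ennreal (?n (y \<bullet> b - x \<bullet> b))) \<partial>lborel)"
    using assms by (intro nn_integral_cong) (simp add: heatK_eq_prod prod_ennreal inner_diff_left)
  also have "\<dots> = (\<Prod>b\<in>Basis. \<integral>\<^sup>+y. ennreal (?n (y - x \<bullet> b)) \<partial>lborel)"
    by (subst nn_integral_lborel_prod[where f="\<lambda>b y. ennreal (?n (y - x \<bullet> b))"]) auto
  finally show ?thesis by (simp add: 1)
qed

lemma heatK_uminus: "heatK t (x - y) = heatK t (y - x)"
  by (simp add: heatK_def norm_minus_commute)

lemma nn_integral_heatK':
  fixes x :: "real^'n"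
  shows "0 < t \<Longrightarrow> (\<integral>\<^sup>+y. ennreal (heatK t (x - y)) \<partial>lborel) = 1"
  by (subst heatK_uminus) (rule nn_integral_heatK)

text \<open>Since \<open>s + t \<le> 2 * t\<close>, the prefactor shrinks by at most a dimensional
  constant, while the exponential can only grow. A Gaussian weight thus survives smoothing over a
  time not longer than its own.\<close>

lemma heatK_doubling:
  fixes x :: "real^'n"
  assumes "0 < s" "s \<le> t"
  shows "2 powr (- real CARD('n) / 2) * heatK t x \<le> heatK (s + t) x"
proof -
  have "2 powr (- real CARD('n) / 2) * heatK t x = (4 * pi * (2 * t)) powr (- real CARD('n) / 2) * exp (- (norm x)\<^sup>2 / (4 * t))"
    using assms unfolding heatK_def by (simp add: powr_mult[symmetric] mult_ac)
  also have "\<dots> \<le> (4 * pi * (s + t)) powr (- real CARD('n) / 2) * exp (- (norm x)\<^sup>2 / (4 * (s + t)))"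
    using assms by (intro mult_mono powr_mono2') (auto simp: frac_le)
  finally show ?thesis by (simp add: heatK_def)
qed

text \<open>The exponent is handled by
  \<open>|x - z|\<^sup>2 \<le> (1 + t/s) |z|\<^sup>2 + (1 + s/t) |x|\<^sup>2\<close>, whose first coefficient cancels against
  the shifted time.\<close>

lemma heatK_Harnack:
  fixes x z :: "real^'n"
  assumes s: "0 < s" and t: "0 < t"
  shows "(1 + t / s) powr (- real CARD('n) / 2) * exp (- (norm x)\<^sup>2 / (4 * t)) * heatK s z
      \<le> heatK (s + t) (x - z)"
proof -
  have "0 \<le> (norm (t *\<^sub>R z + s *\<^sub>R x))\<^sup>2" by simp
  also have "\<dots> = (s + t) * (t * (norm z)\<^sup>2 + s * (norm x)\<^sup>2) - s * t * (norm (x - z))\<^sup>2"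
    unfolding power2_norm_eq_inner by (simp add: inner_simps inner_commute algebra_simps power2_eq_square)
  finally have "(norm (x - z))\<^sup>2 * (s * t) \<le> (s + t) * (t * (norm z)\<^sup>2 + s * (norm x)\<^sup>2)"
    by (simp add: mult_ac)
  then have E: "(norm (x - z))\<^sup>2 / (4 * (s + t)) \<le> (norm x)\<^sup>2 / (4 * t) + (norm z)\<^sup>2 / (4 * s)"
    using s t by (simp add: field_simps)
  have "(1 + t / s) powr (- real CARD('n) / 2) * (4 * pi * s) powr (- real CARD('n) / 2)
     = ((1 + t / s) * (4 * pi * s)) powr (- real CARD('n) / 2)"
    using s t by (subst powr_mult) auto
  also have "(1 + t / s) * (4 * pi * s) = 4 * pi * (s + t)"
    using s by (simp add: field_simps)
  finally have P: "(1 + t / s) powr (- real CARD('n) / 2) * (4 * pi * s) powr (- real CARD('n) / 2)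
     = (4 * pi * (s + t)) powr (- real CARD('n) / 2)" .
  have "(1 + t / s) powr (- real CARD('n) / 2) * exp (- (norm x)\<^sup>2 / (4 * t)) * heatK s z
     = (4 * pi * (s + t)) powr (- real CARD('n) / 2) * exp (- ((norm x)\<^sup>2 / (4 * t) + (norm z)\<^sup>2 / (4 * s)))"
    unfolding heatK_def P[symmetric] by (simp add: exp_add[symmetric] exp_minus field_simps)
  also have "\<dots> \<le> heatK (s + t) (x - z)"
    unfolding heatK_def using E by (intro mult_left_mono) auto
  finally show ?thesis .
qed

section \<open>Potentials\<close>

text \<open>Makes the projections of \<open>borel\<close> on a product space, here identified with
  the product sigma-algebra, available to the measurability prover.\<close>

lemma borel_measurable_fst_snd [measurable (raw)]:
  fixes f :: "'a \<Rightarrow> 'b::second_countable_topology \<times> 'c::second_countable_topology"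
  assumes "f \<in> borel_measurable M"
  shows "(\<lambda>x. fst (f x)) \<in> borel_measurable M" "(\<lambda>x. snd (f x)) \<in> borel_measurable M"
  using assms by (simp_all add: measurable_compose[OF _ measurable_fst] measurable_compose[OF _ measurable_snd] flip: borel_prod)

lemma nn_integral_pair_lborel:
  fixes h :: "'a::euclidean_space \<times> 'b::euclidean_space \<Rightarrow> ennreal"
  assumes [measurable]: "h \<in> borel_measurable borel"
  shows "(\<integral>\<^sup>+zs. h zs \<partial>lborel) = (\<integral>\<^sup>+s. \<integral>\<^sup>+z. h (z, s) \<partial>lborel \<partial>lborel)"
proof -
  have "h \<in> borel_measurable (lborel \<Otimes>\<^sub>M lborel)"
    by (simp add: lborel_prod)
  from lborel_pair.nn_integral_snd[OF this] show ?thesis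
    by (simp add: lborel_prod)
qed

section \<open>Integrals of powers of time and the spatial mass of the kernel\<close>

lemma nn_integral_powr_from_0:
  fixes a \<sigma> :: real
  assumes "0 < \<sigma>" "0 \<le> a"
  shows "(\<integral>\<^sup>+t. ennreal (t powr (\<sigma> - 1)) * indicator {0..a} t \<partial>lborel) = ennreal (a powr \<sigma> / \<sigma>)"
  using has_integral_powr_from_0[of "\<sigma> - 1" a] assms
  by (subst nn_integral_has_integral_lebesgue') auto

lemma nn_integral_powr_left:
  fixes a b \<sigma> :: real
  assumes "0 < \<sigma>" "a \<le> b"
  shows "(\<integral>\<^sup>+t. ennreal ((t - a) powr (\<sigma> - 1)) * indicator {a..b} t \<partial>lborel) = ennreal ((b - a) powr \<sigma> / \<sigma>)"
  by (subst nn_integral_real_affine[of _ 1 a], use assms in \<open>simp_all flip: nn_integral_powr_from_0\<close>)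
    (auto intro!: nn_integral_cong simp: indicator_def)

lemma nn_integral_powr_right:
  fixes a b \<sigma> :: real
  assumes "0 < \<sigma>" "a \<le> b"
  shows "(\<integral>\<^sup>+t. ennreal ((b - t) powr (\<sigma> - 1)) * indicator {a..b} t \<partial>lborel) = ennreal ((b - a) powr \<sigma> / \<sigma>)"
  by (subst nn_integral_real_affine[of _ "-1" b], use assms in \<open>simp_all flip: nn_integral_powr_from_0\<close>)
    (auto intro!: nn_integral_cong simp: indicator_def)

lemma Gker_nonneg [simp]: "0 < \<sigma> \<Longrightarrow> 0 \<le> Gker \<sigma> x t"
  by (simp add: Gker_def)

lemma Gker_pos: "0 < \<sigma> \<Longrightarrow> 0 < t \<Longrightarrow> 0 < Gker \<sigma> x t"
  by (simp add: Gker_def heatK_pos)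

lemma Gker_eq_0: "t \<le> 0 \<Longrightarrow> Gker \<sigma> x t = 0"
  by (simp add: Gker_def)

lemma nn_integral_Gker:
  fixes x :: "real^'n"
  assumes "0 < \<sigma>" "0 < t"
  shows "(\<integral>\<^sup>+z. ennreal (Gker \<sigma> (x - z) t) \<partial>lborel) = ennreal (t powr (\<sigma> - 1) / Gamma \<sigma>)"
proof -
  have "(\<integral>\<^sup>+z. ennreal (Gker \<sigma> (x - z) t) \<partial>lborel)
     = (\<integral>\<^sup>+z. ennreal (t powr (\<sigma> - 1) / Gamma \<sigma>) * ennreal (heatK t (x - z)) \<partial>lborel)"
    using assms by (intro nn_integral_cong) (simp add: Gker_def ennreal_mult[symmetric] mult_ac)
  also have "\<dots> = ennreal (t powr (\<sigma> - 1) / Gamma \<sigma>)"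
    using assms by (subst nn_integral_cmult) (simp_all add: nn_integral_heatK')
  finally show ?thesis .
qed

section \<open>The potential operator: monotonicity, semigroup comparison and Harnack
  inequality\<close>

text \<open>Values in \<open>ennreal\<close> give the potential a meaning without integrability
  conditions. As \<open>Gker\<close> vanishes at nonpositive times, only the past
  \<open>snd zs < t\<close> of the source enters.\<close>

definition pot :: "real \<Rightarrow> ((real^'n) \<times> real \<Rightarrow> ennreal) \<Rightarrow> real^'n \<Rightarrow> real \<Rightarrow> ennreal" where
  "pot \<sigma> w x t = (\<integral>\<^sup>+zs. w zs * ennreal (Gker \<sigma> (x - fst zs) (t - snd zs)) \<partial>lborel)"

lemma borel_measurable_pot [measurable (raw)]:
  fixes M :: "'a measure" and w :: "(real^'n) \<times> real \<Rightarrow> ennreal"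
  assumes [measurable]: "w \<in> borel_measurable borel" "f \<in> borel_measurable M" "g \<in> borel_measurable M"
  shows "(\<lambda>y. pot \<sigma> w (f y) (g y)) \<in> borel_measurable M"
proof -
  have [measurable]: "(\<lambda>q. w (snd q)) \<in> borel_measurable (M \<Otimes>\<^sub>M lborel)"
    "(\<lambda>q::'a \<times> (real^'n) \<times> real. snd q) \<in> borel_measurable (M \<Otimes>\<^sub>M lborel)"
    by measurable
  show ?thesis unfolding pot_def by measurable
qed

lemma pot_mono:
  assumes "0 < \<sigma>" "\<And>z s. s < t \<Longrightarrow> w (z, s) \<le> w' (z, s)"
  shows "pot \<sigma> w x t \<le> pot \<sigma> w' x t"
  unfolding pot_def
proof (intro nn_integral_mono)
  fix zs :: "(real^'a) \<times> real"
  show "w zs * ennreal (Gker \<sigma> (x - fst zs) (t - snd zs)) \<le> w' zs * ennreal (Gker \<sigma> (x - fst zs) (t - snd zs))"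
    using assms(2)[of "snd zs" "fst zs"] by (cases "snd zs < t") (auto simp: Gker_eq_0 intro: mult_right_mono)
qed

lemma pot_add:
  assumes [measurable]: "w \<in> borel_measurable borel" "w' \<in> borel_measurable borel"
  shows "pot \<sigma> (\<lambda>zs. w zs + w' zs) x t = pot \<sigma> w x t + pot \<sigma> w' x t"
  unfolding pot_def by (subst nn_integral_add[symmetric]) (auto simp: distrib_right)

text \<open>Integrating out space leaves the mass of \<open>Gker\<close>, so on sources depending on
  time only the potential is the Riemann-Liouville fractional integral of order \<sigma>.\<close>

lemma pot_time:
  fixes x :: "real^'n" and h :: "real \<Rightarrow> ennreal"
  assumes "0 < \<sigma>" and [measurable]: "h \<in> borel_measurable borel"
  shows "pot \<sigma> (\<lambda>zs. h (snd zs)) x t =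
    (\<integral>\<^sup>+s. h s * (ennreal ((t - s) powr (\<sigma> - 1) / Gamma \<sigma>) * indicator {..<t} s) \<partial>lborel)"
proof -
  have "pot \<sigma> (\<lambda>zs. h (snd zs)) x t = (\<integral>\<^sup>+s. \<integral>\<^sup>+z. h s * ennreal (Gker \<sigma> (x - z) (t - s)) \<partial>lborel \<partial>lborel)"
    unfolding pot_def by (subst nn_integral_pair_lborel) auto
  also have "\<dots> = (\<integral>\<^sup>+s. h s * (ennreal ((t - s) powr (\<sigma> - 1) / Gamma \<sigma>) * indicator {..<t} s) \<partial>lborel)"
  proof (intro nn_integral_cong)
    fix s :: real
    show "(\<integral>\<^sup>+z. h s * ennreal (Gker \<sigma> (x - z) (t - s)) \<partial>lborel)
      = h s * (ennreal ((t - s) powr (\<sigma> - 1) / Gamma \<sigma>) * indicator {..<t} s)"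
      using assms by (cases "s < t") (simp_all add: nn_integral_cmult nn_integral_Gker Gker_eq_0)
  qed
  finally show ?thesis .
qed

lemma pot_indicator:
  fixes x :: "real^'n"
  assumes "0 < \<sigma>" "a \<le> t"
  shows "pot \<sigma> (\<lambda>zs. c * indicator {a..} (snd zs)) x t = c * ennreal ((t - a) powr \<sigma> / (\<sigma> * Gamma \<sigma>))"
proof -
  have "pot \<sigma> (\<lambda>zs. c * indicator {a..} (snd zs)) x t
    = (\<integral>\<^sup>+s. (c * ennreal (1 / Gamma \<sigma>)) * (ennreal ((t - s) powr (\<sigma> - 1)) * indicator {a..t} s) \<partial>lborel)"
    using assms by (subst pot_time) 
      (auto intro!: nn_integral_cong simp: indicator_def mult.assoc ennreal_mult[symmetric])
  also have "\<dots> = (c * ennreal (1 / Gamma \<sigma>)) * ennreal ((t - a) powr \<sigma> / \<sigma>)"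
    by (subst nn_integral_cmult) (use assms in \<open>simp_all add: nn_integral_powr_right\<close>)
  also have "\<dots> = c * ennreal ((t - a) powr \<sigma> / (\<sigma> * Gamma \<sigma>))"
    using assms by (simp add: mult.assoc ennreal_mult[symmetric] mult_ac)
  finally show ?thesis .
qed

text \<open>For a source living before \<open>t0\<close>, the time weight at \<open>t\<close> is at
  most the one at \<open>t0\<close> because \<sigma> \<le> 1. With the weight of \<open>t0\<close>
  in place, the semigroup property factors the heat kernel through time \<open>t0\<close>, and
  Tonelli exchanges the integrals.\<close>

lemma pot_le_semigroup:
  fixes x :: "real^'n"
  assumes \<sigma>: "0 < \<sigma>" "\<sigma> \<le> 1" and t: "t0 < t" and [measurable]: "w \<in> borel_measurable borel"
    and w: "\<And>z s. t0 \<le> s \<Longrightarrow> w (z, s) = 0"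
  shows "pot \<sigma> w x t \<le> (\<integral>\<^sup>+y. ennreal (heatK (t - t0) (x - y)) * pot \<sigma> w y t0 \<partial>lborel)"
proof -
  have *: "w zs * ennreal (Gker \<sigma> (x - fst zs) (t - snd zs)) \<le>
      (\<integral>\<^sup>+y. ennreal (heatK (t - t0) (x - y)) * (w zs * ennreal (Gker \<sigma> (y - fst zs) (t0 - snd zs))) \<partial>lborel)" for zs
  proof (cases "snd zs < t0")
    case True
    let ?s = "snd zs" and ?z = "fst zs"
    let ?c = "(t0 - ?s) powr (\<sigma> - 1) / Gamma \<sigma>"
    have "Gker \<sigma> (x - ?z) (t - ?s) \<le> ?c * heatK (t - ?s) (x - ?z)"
      using True t \<sigma> by (auto simp: Gker_def divide_simps mult.commute intro!: mult_right_mono powr_mono2')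
    then have "w zs * ennreal (Gker \<sigma> (x - ?z) (t - ?s)) \<le> w zs * ennreal (?c * heatK ((t - t0) + (t0 - ?s)) (x - ?z))"
      by (intro mult_left_mono ennreal_leI) auto
    also have "\<dots> = (w zs * ennreal ?c) * (\<integral>\<^sup>+y. ennreal (heatK (t - t0) (x - y)) * ennreal (heatK (t0 - ?s) (y - ?z)) \<partial>lborel)"
      using True t \<sigma> by (subst nn_integral_heatK_conv) (auto simp: ennreal_mult[symmetric] mult.assoc)
    also have "\<dots> = (\<integral>\<^sup>+y. (w zs * ennreal ?c) * (ennreal (heatK (t - t0) (x - y)) * ennreal (heatK (t0 - ?s) (y - ?z))) \<partial>lborel)"
      by (subst nn_integral_cmult) auto
    also have "\<dots> = (\<integral>\<^sup>+y. ennreal (heatK (t - t0) (x - y)) * (w zs * ennreal (Gker \<sigma> (y - ?z) (t0 - ?s))) \<partial>lborel)"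
    proof (intro nn_integral_cong)
      fix y :: "real^'n"
      have "ennreal (Gker \<sigma> (y - ?z) (t0 - ?s)) = ennreal ?c * ennreal (heatK (t0 - ?s) (y - ?z))"
        using True \<sigma> by (simp add: Gker_def ennreal_mult[symmetric] mult_ac)
      then show "(w zs * ennreal ?c) * (ennreal (heatK (t - t0) (x - y)) * ennreal (heatK (t0 - ?s) (y - ?z)))
        = ennreal (heatK (t - t0) (x - y)) * (w zs * ennreal (Gker \<sigma> (y - ?z) (t0 - ?s)))"
        by (simp add: mult_ac)
    qed
    finally show ?thesis .
  next
    case False
    then show ?thesis using w[of "snd zs" "fst zs"] by simp
  qed
  have "pot \<sigma> w x t \<le> (\<integral>\<^sup>+zs. \<integral>\<^sup>+y. ennreal (heatK (t - t0) (x - y)) * (w zs * ennreal (Gker \<sigma> (y - fst zs) (t0 - snd zs))) \<partial>lborel \<partial>lborel)"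
    unfolding pot_def by (intro nn_integral_mono *)
  also have "\<dots> = (\<integral>\<^sup>+y. \<integral>\<^sup>+zs. ennreal (heatK (t - t0) (x - y)) * (w zs * ennreal (Gker \<sigma> (y - fst zs) (t0 - snd zs))) \<partial>lborel \<partial>lborel)"
    by (subst lborel_pair.Fubini') auto
  also have "\<dots> = (\<integral>\<^sup>+y. ennreal (heatK (t - t0) (x - y)) * pot \<sigma> w y t0 \<partial>lborel)"
    unfolding pot_def by (intro nn_integral_cong nn_integral_cmult) auto
  finally show ?thesis .
qed

text \<open>\<open>heatK_Harnack\<close> is applied under the integral to a source point of age
  \<open>r = t0 - snd zs\<close>. The loss depends on \<open>r\<close> only through
  \<open>1 + t / r\<close>, and the worst case is the smallest age \<open>r = a\<close>.\<close>

lemma pot_Harnack: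
  fixes x y :: "real^'n"
  assumes \<sigma>: "0 < \<sigma>" "\<sigma> \<le> 1" and a: "0 < a" and t: "0 < t"
    and [measurable]: "w \<in> borel_measurable borel"
    and w: "\<And>z s. t0 - a < s \<Longrightarrow> w (z, s) = 0"
  shows "ennreal ((1 + t / a) powr (\<sigma> - 1 - real CARD('n) / 2) * exp (- (norm x)\<^sup>2 / (4 * t))) * pot \<sigma> w y t0
    \<le> pot \<sigma> w (y + x) (t0 + t)"
proof -
  have "ennreal ((1 + t / a) powr (\<sigma> - 1 - real CARD('n) / 2) * exp (- (norm x)\<^sup>2 / (4 * t))) * pot \<sigma> w y t0
    = (\<integral>\<^sup>+zs. ennreal ((1 + t / a) powr (\<sigma> - 1 - real CARD('n) / 2) * exp (- (norm x)\<^sup>2 / (4 * t)))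
        * (w zs * ennreal (Gker \<sigma> (y - fst zs) (t0 - snd zs))) \<partial>lborel)"
    unfolding pot_def by (subst nn_integral_cmult) auto
  also have "\<dots> \<le> pot \<sigma> w (y + x) (t0 + t)"
    unfolding pot_def
  proof (intro nn_integral_mono)
  fix zs :: "(real^'n) \<times> real"
  let ?b = "\<sigma> - 1 - real CARD('n) / 2"
  let ?E = "exp (- (norm x)\<^sup>2 / (4 * t))"
  show "ennreal ((1 + t / a) powr ?b * ?E) * (w zs * ennreal (Gker \<sigma> (y - fst zs) (t0 - snd zs)))
    \<le> w zs * ennreal (Gker \<sigma> (y + x - fst zs) (t0 + t - snd zs))"
  proof (cases "t0 - a < snd zs")
    case True
    then show ?thesis using w[of "snd zs" "fst zs"] by simp
  next
    case False
    define r where "r = t0 - snd zs"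
    have e: "t0 - snd zs = r" "t0 + t - snd zs = r + t" by (auto simp: r_def)
    have r: "a \<le> r" "0 < r" using False a by (auto simp: r_def)
    have rt: "(1 + t / r) * r = r + t" using r(2) by (simp add: field_simps)
    have split: "(1 + t / r) powr ?b = (1 + t / r) powr (\<sigma> - 1) * (1 + t / r) powr (- real CARD('n) / 2)"
      by (simp add: powr_add[symmetric])
    \<comment> \<open>The exponent \<open>?b\<close> is not positive, so the larger base
      \<open>1 + t / a\<close> gives the smaller power.\<close>
    have "(1 + t / a) powr ?b \<le> (1 + t / r) powr ?b"
      using r a t \<sigma> by (intro powr_mono2' add_pos_pos divide_pos_pos) (auto simp: frac_le)
    then have "(1 + t / a) powr ?b * ?E * (heatK r (y - fst zs) * r powr (\<sigma> - 1))
      \<le> (1 + t / r) powr ?b * ?E * (heatK r (y - fst zs) * r powr (\<sigma> - 1))"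
      using \<sigma> by (intro mult_right_mono) auto
    also have "\<dots> = ((1 + t / r) powr (\<sigma> - 1) * r powr (\<sigma> - 1)) *
      ((1 + t / r) powr (- real CARD('n) / 2) * ?E * heatK r (fst zs - y))"
      by (simp add: split heatK_uminus[of _ "fst zs"] mult_ac)
    \<comment> \<open>The part \<open>\<sigma> - 1\<close> of the exponent shifts the time weight of
      \<open>Gker\<close> exactly; the rest is the loss of the heat kernel.\<close>
    also have "(1 + t / r) powr (\<sigma> - 1) * r powr (\<sigma> - 1) = (r + t) powr (\<sigma> - 1)"
      by (simp only: powr_mult[symmetric] rt)
    also have "(r + t) powr (\<sigma> - 1) * ((1 + t / r) powr (- real CARD('n) / 2) * ?E * heatK r (fst zs - y))
      \<le> (r + t) powr (\<sigma> - 1) * heatK (r + t) (x - (fst zs - y))"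
      using r t by (intro mult_left_mono heatK_Harnack) auto
    finally have "(1 + t / a) powr ?b * ?E * (heatK r (y - fst zs) * r powr (\<sigma> - 1)) / Gamma \<sigma>
       \<le> (r + t) powr (\<sigma> - 1) * heatK (r + t) (x - (fst zs - y)) / Gamma \<sigma>"
      using \<sigma> by (intro divide_right_mono) auto
    then have "(1 + t / a) powr ?b * ?E * Gker \<sigma> (y - fst zs) r \<le> Gker \<sigma> (y + x - fst zs) (r + t)"
      using r t by (simp add: Gker_def mult_ac algebra_simps)
    then have "w zs * ennreal ((1 + t / a) powr ?b * ?E * Gker \<sigma> (y - fst zs) r) \<le> w zs * ennreal (Gker \<sigma> (y + x - fst zs) (r + t))"
      by (intro mult_left_mono ennreal_leI) auto
    then show ?thesis
      using \<sigma> unfolding e by (simp add: ennreal_mult mult_ac)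
  qed
  qed
  finally show ?thesis .
qed

section \<open>Testing with a Gaussian\<close>

lemma nn_integral_strip:
  fixes x0 :: "real^'n"
  assumes "0 < K" "a \<le> b" "0 \<le> c"
  shows "(\<integral>\<^sup>+zs. ennreal (heatK K (fst zs - x0) * c) * indicator {a<..<b} (snd zs) \<partial>lborel) = ennreal (c * (b - a))"
proof -
  have "(\<integral>\<^sup>+zs. ennreal (heatK K (fst zs - x0) * c) * indicator {a<..<b} (snd zs) \<partial>lborel)
    = (\<integral>\<^sup>+s. \<integral>\<^sup>+z. (ennreal c * indicator {a<..<b} s) * ennreal (heatK K (z - x0)) \<partial>lborel \<partial>lborel)"
    using assms by (subst nn_integral_pair_lborel) (auto simp: ennreal_mult mult_ac)
  also have "\<dots> = (\<integral>\<^sup>+s. ennreal c * indicator {a<..<b} s \<partial>lborel)"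
    using assms by (subst nn_integral_cmult) (simp_all add: nn_integral_heatK)
  also have "\<dots> = ennreal (c * (b - a))"
    using assms by (subst nn_integral_cmult) (simp_all add: ennreal_mult)
  finally show ?thesis .
qed

text \<open>Tonelli moves the kernel from the source to the test function; the inner integral on the
  right is the adjoint (backward) potential of \<open>\<psi>\<close>.\<close>

lemma pot_duality:
  fixes \<psi> w :: "(real^'n) \<times> real \<Rightarrow> ennreal"
  assumes [measurable]: "\<psi> \<in> borel_measurable borel" "w \<in> borel_measurable borel"
  shows "(\<integral>\<^sup>+xt. \<psi> xt * pot \<sigma> w (fst xt) (snd xt) \<partial>lborel)
    = (\<integral>\<^sup>+zs. w zs * (\<integral>\<^sup>+xt. \<psi> xt * ennreal (Gker \<sigma> (fst xt - fst zs) (snd xt - snd zs)) \<partial>lborel) \<partial>lborel)"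
proof -
  have "(\<integral>\<^sup>+xt. \<psi> xt * pot \<sigma> w (fst xt) (snd xt) \<partial>lborel)
    = (\<integral>\<^sup>+xt. \<integral>\<^sup>+zs. \<psi> xt * (w zs * ennreal (Gker \<sigma> (fst xt - fst zs) (snd xt - snd zs))) \<partial>lborel \<partial>lborel)"
    unfolding pot_def by (subst nn_integral_cmult) auto
  also have "\<dots> = (\<integral>\<^sup>+zs. \<integral>\<^sup>+xt. \<psi> xt * (w zs * ennreal (Gker \<sigma> (fst xt - fst zs) (snd xt - snd zs))) \<partial>lborel \<partial>lborel)"
    by (subst lborel_pair.Fubini') auto
  also have "\<dots> = (\<integral>\<^sup>+zs. w zs * (\<integral>\<^sup>+xt. \<psi> xt * ennreal (Gker \<sigma> (fst xt - fst zs) (snd xt - snd zs)) \<partial>lborel) \<partial>lborel)"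
    by (subst nn_integral_cmult[symmetric]) (auto simp: mult_ac)
  finally show ?thesis .
qed

text \<open>Convolving the weight \<open>heatK K\<close> with the kernel of age \<open>t - s\<close>
  gives a heat kernel of time \<open>K + (t - s)\<close>, comparable with \<open>heatK K\<close> by
  doubling since \<open>t - s \<le> K\<close>. Only the first half of \<open>(s, e)\<close> is kept:
  there \<open>e - t\<close> is at least \<open>(e - s) / 2\<close>, and integrating
  \<open>(t - s) powr (\<sigma> - 1)\<close> yields the extra power \<sigma>.\<close>

lemma adjoint_potential_ge:
  fixes z x0 :: "real^'n"
  assumes \<sigma>: "0 < \<sigma>" and k: "0 \<le> k" and s: "e - K \<le> s" "s < e" and K: "0 < K"
  shows "ennreal (2 powr (- real CARD('n) / 2 - k - \<sigma>) / (\<sigma> * Gamma \<sigma>) * heatK K (z - x0) * (e - s) powr (k + \<sigma>))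
    \<le> (\<integral>\<^sup>+xt. (ennreal (heatK K (fst xt - x0) * (e - snd xt) powr k) * indicator {e - K<..<e} (snd xt))
        * ennreal (Gker \<sigma> (fst xt - z) (snd xt - s)) \<partial>lborel)"
proof -
  define m where "m = (s + e) / 2"
  define D where "D = ((e - s) / 2) powr k * (2 powr (- real CARD('n) / 2) * heatK K (z - x0)) / Gamma \<sigma>"
  have sm: "s < m" "m < e" using s by (auto simp: m_def)
  have D0: "0 \<le> D" using \<sigma> by (simp add: D_def)
  have inner: "ennreal D * (ennreal ((t - s) powr (\<sigma> - 1)) * indicator {s..m} t) \<le>
      (\<integral>\<^sup>+x. (ennreal (heatK K (x - x0) * (e - t) powr k) * indicator {e - K<..<e} t)
        * ennreal (Gker \<sigma> (x - z) (t - s)) \<partial>lborel)" for t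
  \<comment> \<open>The endpoint \<open>t = s\<close> falls into the trivial case because
    \<open>0 powr (\<sigma> - 1)\<close> is \<open>0\<close>.\<close>
  proof (cases "t \<in> {s<..m}")
    case True
    then have t: "s < t" "t \<le> m" "t < e" "e - K < t" using s sm by auto
    let ?c = "(e - t) powr k * (t - s) powr (\<sigma> - 1) / Gamma \<sigma>"
    have "D * (t - s) powr (\<sigma> - 1) \<le> (e - t) powr k * heatK (t - s + K) (z - x0) / Gamma \<sigma> * (t - s) powr (\<sigma> - 1)"
      unfolding D_def using t \<sigma> k s
      by (intro mult_right_mono divide_right_mono mult_mono powr_mono2 heatK_doubling) (auto simp: m_def)
    then have "ennreal D * (ennreal ((t - s) powr (\<sigma> - 1)) * indicator {s..m} t) \<le> ennreal (?c * heatK (K + (t - s)) (x0 - z))"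
      using t D0 \<sigma> by (auto simp: ennreal_mult[symmetric] mult_ac add_ac heatK_uminus[of _ z] intro!: ennreal_leI)
    also have "\<dots> = ennreal ?c * (\<integral>\<^sup>+x. ennreal (heatK K (x0 - x)) * ennreal (heatK (t - s) (x - z)) \<partial>lborel)"
      using t K \<sigma> by (subst nn_integral_heatK_conv) (auto simp: ennreal_mult[symmetric])
    also have "\<dots> = (\<integral>\<^sup>+x. (ennreal (heatK K (x - x0) * (e - t) powr k) * indicator {e - K<..<e} t)
        * ennreal (Gker \<sigma> (x - z) (t - s)) \<partial>lborel)"
      using t \<sigma> by (subst nn_integral_cmult[symmetric])
        (auto simp: Gker_def ennreal_mult[symmetric] heatK_uminus[of _ x0] mult_ac intro!: nn_integral_cong)
    finally show ?thesis .
  qed (auto simp: indicator_def)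
  have p2: "2 powr (- real CARD('n) / 2 - k - \<sigma>) = 2 powr (- real CARD('n) / 2) / (2 powr k * 2 powr \<sigma>)"
    by (simp add: powr_diff)
  have "2 powr (- real CARD('n) / 2 - k - \<sigma>) / (\<sigma> * Gamma \<sigma>) * heatK K (z - x0) * (e - s) powr (k + \<sigma>)
    = D * ((m - s) powr \<sigma> / \<sigma>)"
    using s unfolding p2 by (simp add: D_def m_def powr_add powr_divide field_simps)
  then have "ennreal (2 powr (- real CARD('n) / 2 - k - \<sigma>) / (\<sigma> * Gamma \<sigma>) * heatK K (z - x0) * (e - s) powr (k + \<sigma>))
    = ennreal D * ennreal ((m - s) powr \<sigma> / \<sigma>)"
    using \<sigma> D0 by (simp add: ennreal_mult[symmetric])
  also have "\<dots> = (\<integral>\<^sup>+t. ennreal D * (ennreal ((t - s) powr (\<sigma> - 1)) * indicator {s..m} t) \<partial>lborel)"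
    using \<sigma> sm by (subst nn_integral_cmult) (auto simp: nn_integral_powr_left)
  also have "\<dots> \<le> (\<integral>\<^sup>+t. \<integral>\<^sup>+x. (ennreal (heatK K (x - x0) * (e - t) powr k) * indicator {e - K<..<e} t)
        * ennreal (Gker \<sigma> (x - z) (t - s)) \<partial>lborel \<partial>lborel)"
    by (intro nn_integral_mono inner)
  also have "\<dots> = (\<integral>\<^sup>+xt. (ennreal (heatK K (fst xt - x0) * (e - snd xt) powr k) * indicator {e - K<..<e} (snd xt))
        * ennreal (Gker \<sigma> (fst xt - z) (snd xt - s)) \<partial>lborel)"
    by (subst nn_integral_pair_lborel) auto
  finally show ?thesis .
qed

text \<open>The setting of both rate estimates. \<open>U\<close> stands for the solution cut off to
  times in \<open>(0, T)\<close>; the datum survives only as the constant \<open>C\<close>, through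
  a two-sided comparison of \<open>U\<close> with the potential of its own power.\<close>

locale mild_solution =
  fixes \<sigma> p T C :: real and U :: "(real^'n) \<times> real \<Rightarrow> real"
  assumes \<sigma>: "0 < \<sigma>" "\<sigma> < 1" and p: "1 < p" and T: "0 < T" and C: "0 \<le> C"
    and meas [measurable]: "U \<in> borel_measurable borel"
    and nonneg: "0 \<le> U zs"
    and initial: "s \<le> 0 \<Longrightarrow> U (z, s) = 0"
    and bdd: "t < T \<Longrightarrow> \<exists>B. \<forall>z s. s \<le> t \<longrightarrow> U (z, s) \<le> B"
    and upper: "0 < t \<Longrightarrow> t < T \<Longrightarrow> ennreal (U (x, t)) \<le> pot \<sigma> (\<lambda>zs. ennreal (U zs powr p)) x t + ennreal C"
    and lower: "0 < t \<Longrightarrow> t < T \<Longrightarrow> pot \<sigma> (\<lambda>zs. ennreal (U zs powr p)) x t \<le> ennreal (U (x, t) + C)"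
begin

lemma Gamma_pos: "0 < Gamma \<sigma>"
  using \<sigma> by simp

text \<open>The exponent \<open>k\<close> makes the space-time weight in Young's inequality exactly Gaussian.\<close>

lemma test_function_bound:
  fixes x0 :: "real^'n" and K e :: real
  defines "k \<equiv> \<sigma> / (p - 1)"
  defines "c \<equiv> 2 powr (- real CARD('n) / 2 - k - \<sigma>) / (\<sigma> * Gamma \<sigma>)"
  assumes K: "0 < K" "K \<le> e" "e < T"
  shows "(\<integral>\<^sup>+zs. ennreal (heatK K (fst zs - x0) * (U zs * (e - snd zs) powr k) powr p) * indicator {e - K<..<e} (snd zs) \<partial>lborel)
    \<le> ennreal (2 / c * ((2 / c) powr (1 / (p - 1)) * K + C * K powr (k + 1)))" (is "?I \<le> _")
proof -
  let ?w = "\<lambda>zs. ennreal (U zs powr p)"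
  let ?C1 = "(2 / c) powr (1 / (p - 1))"
  let ?y = "\<lambda>zs. U zs * (e - snd zs) powr k"
  define \<psi> where "\<psi> = (\<lambda>xt. ennreal (heatK K (fst xt - x0) * (e - snd xt) powr k) * indicator {e - K<..<e} (snd xt))"
  have [measurable]: "\<psi> \<in> borel_measurable borel" unfolding \<psi>_def by measurable
  \<comment> \<open>The identity \<open>k * p = k + \<sigma>\<close> matches the \<open>p\<close>-th
    power of \<open>U * (e - s) powr k\<close> with the power of \<open>e - s\<close> produced by
    the adjoint potential.\<close>
  have k: "0 < k" "k * p = k + \<sigma>" using \<sigma> p by (auto simp: k_def field_simps)
  have c: "0 < c" using \<sigma> by (simp add: c_def)
  obtain B where B: "\<And>z s. s \<le> e \<Longrightarrow> U (z, s) \<le> B" using bdd K by blast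
  have B0: "0 \<le> B" using B[of e 0] nonneg[of "(0, e)"] by simp
  \<comment> \<open>A crude bound from the boundedness of \<open>U\<close> up to
    \<open>e < T\<close>. Its only purpose is finiteness of \<open>?I\<close>, which allows the
    later absorption of \<open>?I\<close> into the left-hand side.\<close>
  have "?I \<le> (\<integral>\<^sup>+zs. ennreal (heatK K (fst zs - x0) * (B * K powr k) powr p) * indicator {e - K<..<e} (snd zs) \<partial>lborel)"
  proof (intro nn_integral_mono)
    fix zs :: "(real^'n) \<times> real"
    show "ennreal (heatK K (fst zs - x0) * (?y zs) powr p) * indicator {e - K<..<e} (snd zs)
      \<le> ennreal (heatK K (fst zs - x0) * (B * K powr k) powr p) * indicator {e - K<..<e} (snd zs)"
      using B[of "snd zs" "fst zs"] B0 k p nonneg[of zs]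
      by (cases "snd zs \<in> {e - K<..<e}")
        (auto intro!: ennreal_leI mult_left_mono powr_mono2 mult_mono)
  qed
  also have "\<dots> = ennreal ((B * K powr k) powr p * (e - (e - K)))"
    using K by (intro nn_integral_strip) auto
  finally have Ifin: "?I \<noteq> top" by (auto simp: top_unique)
  \<comment> \<open>Young's inequality by cases: above the threshold \<open>?C1\<close> the factor
    \<open>y powr (p - 1)\<close> is at least \<open>2 / c\<close>.\<close>
  have young: "y \<le> c / 2 * y powr p + ?C1" if "0 \<le> y" for y
  proof (cases "y \<le> ?C1")
    case False
    then have y: "0 < y" "?C1 \<le> y" using that by (auto simp: not_le intro: le_less_trans[OF powr_ge_zero])
    have "2 / c = ?C1 powr (p - 1)" using p c by (simp add: powr_powr)
    also have "\<dots> \<le> y powr (p - 1)" using p y by (intro powr_mono2) auto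
    finally have "2 / c * y \<le> y powr (p - 1) * y powr 1" using y by (simp only: powr_one mult_right_mono)
    also have "\<dots> = y powr p" by (subst powr_add[symmetric]) simp
    finally have "c / 2 * (2 / c * y) \<le> c / 2 * y powr p" using c by (intro mult_left_mono) auto
    then have "y \<le> c / 2 * y powr p" using c by simp
    then show ?thesis by (simp add: add_increasing2)
  qed (simp add: add_increasing c less_imp_le)
  \<comment> \<open>The chain runs from \<open>c * ?I\<close> through the adjoint bound, duality and
    \<open>lower\<close> to an integral linear in \<open>U\<close>; Young's inequality then returns
    only half of \<open>c * ?I\<close>.\<close>
  have "ennreal c * ?I = (\<integral>\<^sup>+zs. ennreal c * (ennreal (heatK K (fst zs - x0) * (?y zs) powr p) * indicator {e - K<..<e} (snd zs)) \<partial>lborel)"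
    by (subst nn_integral_cmult) auto
  also have "\<dots> \<le> (\<integral>\<^sup>+zs. ?w zs * (\<integral>\<^sup>+xt. \<psi> xt * ennreal (Gker \<sigma> (fst xt - fst zs) (snd xt - snd zs)) \<partial>lborel) \<partial>lborel)"
  proof (intro nn_integral_mono)
    fix zs :: "(real^'n) \<times> real"
    show "ennreal c * (ennreal (heatK K (fst zs - x0) * (?y zs) powr p) * indicator {e - K<..<e} (snd zs))
      \<le> ?w zs * (\<integral>\<^sup>+xt. \<psi> xt * ennreal (Gker \<sigma> (fst xt - fst zs) (snd xt - snd zs)) \<partial>lborel)"
    proof (cases "snd zs \<in> {e - K<..<e}")
      case True
      have "c * (heatK K (fst zs - x0) * (?y zs) powr p)
        = U zs powr p * (c * heatK K (fst zs - x0) * (e - snd zs) powr (k + \<sigma>))"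
        using True nonneg k(2) by (simp add: powr_mult powr_powr)
      then have "ennreal c * (ennreal (heatK K (fst zs - x0) * (?y zs) powr p) * indicator {e - K<..<e} (snd zs))
        = ?w zs * ennreal (c * heatK K (fst zs - x0) * (e - snd zs) powr (k + \<sigma>))"
        using True c by (simp add: ennreal_mult[symmetric])
      also have "\<dots> \<le> ?w zs * (\<integral>\<^sup>+xt. \<psi> xt * ennreal (Gker \<sigma> (fst xt - fst zs) (snd xt - snd zs)) \<partial>lborel)"
        unfolding c_def \<psi>_def using True k K \<sigma> by (intro mult_left_mono adjoint_potential_ge) auto
      finally show ?thesis .
    qed simp
  qed
  also have "\<dots> = (\<integral>\<^sup>+xt. \<psi> xt * pot \<sigma> ?w (fst xt) (snd xt) \<partial>lborel)"
    by (rule pot_duality[symmetric]) auto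
  also have "\<dots> \<le> (\<integral>\<^sup>+zs. ennreal (c / 2) * (ennreal (heatK K (fst zs - x0) * (?y zs) powr p) * indicator {e - K<..<e} (snd zs))
      + ennreal (heatK K (fst zs - x0) * (?C1 + C * K powr k)) * indicator {e - K<..<e} (snd zs) \<partial>lborel)"
  proof (intro nn_integral_mono)
    fix zs :: "(real^'n) \<times> real"
    show "\<psi> zs * pot \<sigma> ?w (fst zs) (snd zs) \<le> ennreal (c / 2) * (ennreal (heatK K (fst zs - x0) * (?y zs) powr p) * indicator {e - K<..<e} (snd zs))
      + ennreal (heatK K (fst zs - x0) * (?C1 + C * K powr k)) * indicator {e - K<..<e} (snd zs)"
    proof (cases "snd zs \<in> {e - K<..<e}")
      case True
      then have "\<psi> zs * pot \<sigma> ?w (fst zs) (snd zs) \<le> ennreal (heatK K (fst zs - x0) * (e - snd zs) powr k) * ennreal (U zs + C)"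
        using lower[of "snd zs" "fst zs"] K by (auto simp: \<psi>_def intro!: mult_left_mono)
      also have "\<dots> = ennreal (heatK K (fst zs - x0) * (?y zs + C * (e - snd zs) powr k))"
        using nonneg C by (simp add: ennreal_mult[symmetric] algebra_simps)
      also have "\<dots> \<le> ennreal (heatK K (fst zs - x0) * ((c / 2 * (?y zs) powr p + ?C1) + C * K powr k))"
        using True k C nonneg[of zs]
        by (intro ennreal_leI mult_left_mono add_mono young powr_mono2) auto
      also have "\<dots> = ennreal (c / 2) * ennreal (heatK K (fst zs - x0) * (?y zs) powr p) + ennreal (heatK K (fst zs - x0) * (?C1 + C * K powr k))"
        using c C by (simp add: ennreal_mult[symmetric] ennreal_plus[symmetric] algebra_simps del: ennreal_plus)
      finally show ?thesis using True by simp
    qed (simp add: \<psi>_def)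
  qed
  also have "\<dots> = ennreal (c / 2) * ?I + ennreal ((?C1 + C * K powr k) * (e - (e - K)))"
    using K C by (subst nn_integral_add) (auto simp: nn_integral_cmult nn_integral_strip simp del: distrib_right)
  finally have main: "ennreal c * ?I \<le> ennreal (c / 2) * ?I + ennreal ((?C1 + C * K powr k) * K)" by simp
  obtain i where i: "?I = ennreal i" "0 \<le> i" using Ifin by (cases ?I) auto
  define D where "D = (?C1 + C * K powr k) * K"
  have D: "0 \<le> D" using C K by (simp add: D_def)
  have "ennreal (c * i) \<le> ennreal (c / 2 * i + D)"
    using main c i(2) D unfolding i(1) D_def[symmetric] by (simp add: ennreal_mult[symmetric])
  then have "c * i \<le> c / 2 * i + D"
    using c i(2) D by (subst (asm) ennreal_le_iff) auto
  then have "i \<le> 2 / c * ((?C1 + C * K powr k) * K)"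
    using c unfolding D_def[symmetric] by (simp add: field_simps)
  also have "(?C1 + C * K powr k) * K = ?C1 * K + C * K powr (k + 1)"
    using K by (simp add: algebra_simps powr_add)
  finally show ?thesis unfolding i(1) by (rule ennreal_leI)
qed

end

section \<open>Lower rate\<close>

context mild_solution
begin

text \<open>At \<open>t0\<close> the past potential is at most \<open>S + C\<close> by
  \<open>lower\<close>; at later times it is dominated by a heat-kernel average of these
  values.\<close>

lemma pot_past_le:
  assumes t: "0 < t0" "t0 < t" "t < T" and S: "\<And>x. U (x, t0) \<le> S"
  shows "pot \<sigma> (\<lambda>zs. ennreal (U zs powr p) * indicator {..<t0} (snd zs)) x t \<le> ennreal (S + C)"
    (is "pot \<sigma> ?w x t \<le> _")
proof -
  have "pot \<sigma> ?w x t \<le> (\<integral>\<^sup>+y. ennreal (heatK (t - t0) (x - y)) * pot \<sigma> ?w y t0 \<partial>lborel)"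
    using \<sigma> t by (intro pot_le_semigroup) auto
  also have "\<dots> \<le> (\<integral>\<^sup>+y. ennreal (heatK (t - t0) (x - y)) * ennreal (S + C) \<partial>lborel)"
  proof (intro nn_integral_mono mult_left_mono)
    fix y :: "real^'n"
    have "pot \<sigma> ?w y t0 \<le> pot \<sigma> (\<lambda>zs. ennreal (U zs powr p)) y t0"
      using \<sigma> by (intro pot_mono) (auto simp: indicator_def)
    also have "\<dots> \<le> ennreal (U (y, t0) + C)" using t by (intro lower) auto
    also have "\<dots> \<le> ennreal (S + C)" using S by (intro ennreal_leI) simp
    finally show "pot \<sigma> ?w y t0 \<le> ennreal (S + C)" .
  qed auto
  also have "\<dots> = ennreal (S + C)"
    using t by (subst nn_integral_multc) (simp_all add: nn_integral_heatK')
  finally show ?thesis .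
qed

text \<open>If the inequality failed, the source after \<open>t0\<close> would add at most
  \<open>q < A\<close> as long as \<open>U\<close> stays below \<open>2 * A\<close>, so
  \<open>U\<close> would remain strictly below that level and could not become unbounded before
  \<open>T\<close>. In \<open>A\<close>, one \<open>C\<close> comes from \<open>lower\<close> at
  \<open>t0\<close> and the other from \<open>upper\<close> at the later time.\<close>

lemma growth_lower_bound:
  fixes t0 S :: real
  defines "A \<equiv> S + 2 * C"
  assumes t0: "0 < t0" "t0 < T" and S: "\<And>x. U (x, t0) \<le> S" and A: "0 < A"
    and unbounded: "\<And>B. \<exists>x t. t0 < t \<and> t < T \<and> B < U (x, t)"
  shows "A \<le> (T - t0) powr \<sigma> / (\<sigma> * Gamma \<sigma>) * (2 * A) powr p"
proof (rule ccontr)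
  define g where "g = (\<lambda>r::real. r powr \<sigma> / (\<sigma> * Gamma \<sigma>))"
  define q where "q = g (T - t0) * (2 * A) powr p"
  assume "\<not> ?thesis"
  then have q: "q < A" by (simp add: q_def g_def)
  have g0: "0 \<le> g r" for r using \<sigma> by (simp add: g_def)
  have S0: "0 \<le> S" using order_trans[OF nonneg S] .
  \<comment> \<open>The source is split into the past of \<open>t0\<close>, the stretch up to
    \<open>t1\<close> where \<open>U\<close> is at most \<open>2 * A\<close>, and a short remainder
    where only the crude bound \<open>B\<close> is known.\<close>
  have step: "U (x, t) \<le> A + q + g (t - t1) * B powr p"
    if "t0 \<le> t1" "t1 \<le> t" "t0 < t" "t < T"
      and b1: "\<And>z s. t0 < s \<Longrightarrow> s < t1 \<Longrightarrow> U (z, s) \<le> 2 * A"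
      and b2: "\<And>z s. s \<le> t \<Longrightarrow> U (z, s) \<le> B" for x t t1 B
  proof -
    let ?W = "\<lambda>zs. ennreal (U zs powr p)"
    have "pot \<sigma> ?W x t \<le> pot \<sigma> (\<lambda>zs. ?W zs * indicator {..<t0} (snd zs)
      + (ennreal ((2 * A) powr p) * indicator {t0..} (snd zs) + ennreal (B powr p) * indicator {t1..} (snd zs))) x t"
    proof (intro pot_mono)
      fix z :: "real^'n" and s
      assume "s < t"
      consider "s < t0" | "t0 \<le> s" "s < t1 \<or> s = t0" | "t1 \<le> s" by linarith
      then show "?W (z, s) \<le> ?W (z, s) * indicator {..<t0} (snd (z, s))
      + (ennreal ((2 * A) powr p) * indicator {t0..} (snd (z, s)) + ennreal (B powr p) * indicator {t1..} (snd (z, s)))"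
      proof cases
        case 2
        have "S \<le> 2 * A" using S0 C by (simp add: A_def)
        then have "U (z, s) \<le> 2 * A" using 2 b1[of s z] order_trans[OF S[of z]] by (cases "s = t0") auto
        then have "?W (z, s) \<le> ennreal ((2 * A) powr p)"
          using p nonneg by (intro ennreal_leI powr_mono2) auto
        then show ?thesis using 2 by (auto intro: add_increasing2)
      next
        case 3
        have "?W (z, s) \<le> ennreal (B powr p)"
          using p nonneg b2[of s z] \<open>s < t\<close> by (intro ennreal_leI powr_mono2) auto
        then show ?thesis using 3 that by (auto intro: add_increasing)
      qed simp
    qed (use \<sigma> in simp)
    also have "\<dots> = pot \<sigma> (\<lambda>zs. ?W zs * indicator {..<t0} (snd zs)) x t
      + (ennreal ((2 * A) powr p) * ennreal (g (t - t0)) + ennreal (B powr p) * ennreal (g (t - t1)))"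
      using \<sigma> that unfolding g_def by (subst pot_add; (simp; fail)?)+ (simp add: pot_indicator)
    also have "\<dots> \<le> ennreal (S + C) + (ennreal ((2 * A) powr p) * ennreal (g (T - t0)) + ennreal (B powr p) * ennreal (g (t - t1)))"
      using that t0 S \<sigma> Gamma_pos
      by (intro add_mono mult_left_mono ennreal_leI pot_past_le) (auto simp: g_def intro!: divide_right_mono powr_mono2)
    also have "\<dots> = ennreal (S + C + q + g (t - t1) * B powr p)"
      using S0 C g0 by (simp add: q_def ennreal_mult[symmetric] ennreal_plus[symmetric] mult_ac add_ac del: ennreal_plus)
    finally have pot: "pot \<sigma> ?W x t \<le> ennreal (S + C + q + g (t - t1) * B powr p)" .
    have "ennreal (U (x, t)) \<le> pot \<sigma> ?W x t + ennreal C" using that t0 by (intro upper) auto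
    also have "\<dots> \<le> ennreal (S + C + q + g (t - t1) * B powr p) + ennreal C" by (intro add_right_mono pot)
    also have "\<dots> = ennreal (A + q + g (t - t1) * B powr p)"
      using S0 C g0 by (simp add: A_def q_def ennreal_plus[symmetric] algebra_simps del: ennreal_plus)
    finally show ?thesis
      using S0 C g0 A by (subst (asm) ennreal_le_iff) (auto simp: q_def intro!: add_nonneg_nonneg)
  qed
  \<comment> \<open>No continuity of \<open>U\<close> is assumed, so the infimum \<open>t1\<close>
    need not belong to \<open>E\<close>. The contradiction is reached at a time of \<open>E\<close>
    just after \<open>t1\<close>, or at \<open>t1\<close> itself.\<close>
  define E where "E = {t. t0 < t \<and> t < T \<and> (\<exists>x. 2 * A < U (x, t))}"
  obtain t' where t': "t' \<in> E" using unbounded[of "2 * A"] by (auto simp: E_def)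
  define t1 where "t1 = Inf E"
  have bddE: "bdd_below E" by (auto simp: E_def intro!: bdd_belowI[of _ t0])
  have t1: "t0 \<le> t1" "t1 < T"
  proof -
    show "t0 \<le> t1" unfolding t1_def using t' by (intro cInf_greatest) (auto simp: E_def)
    have "t1 \<le> t'" unfolding t1_def using bddE t' by (intro cInf_lower)
    then show "t1 < T" using t' by (auto simp: E_def)
  qed
  have before: "U (z, s) \<le> 2 * A" if "t0 < s" "s < t1" for z s
  proof (rule ccontr)
    assume "\<not> ?thesis"
    then have "s \<in> E" using that t1 by (auto simp: E_def not_le)
    then have "t1 \<le> s" unfolding t1_def by (rule cInf_lower[OF _ bddE])
    then show False using that by simp
  qed
  \<comment> \<open>Any time strictly between \<open>t1\<close> and \<open>T\<close> serves:
    \<open>U\<close> has a bound \<open>B\<close> up to \<open>t2\<close>, fixed before the small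
    step \<open>r\<close> is chosen.\<close>
  define t2 where "t2 = (t1 + T) / 2"
  have t2: "t1 < t2" "t2 < T" using t1 by (auto simp: t2_def)
  obtain B where B: "\<And>z s. s \<le> t2 \<Longrightarrow> U (z, s) \<le> B" using bdd[OF t2(2)] by blast
  \<comment> \<open>The remainder over a time step \<open>r\<close> tends to zero with
    \<open>r\<close>, hence fits into the gap \<open>A - q\<close>.\<close>
  have "((\<lambda>r. g r * B powr p) \<longlongrightarrow> g 0 * B powr p) (at_right 0)"
    unfolding g_def using \<sigma> less_imp_neq[OF Gamma_pos]
    by (intro tendsto_mult tendsto_divide tendsto_powr' tendsto_ident_at tendsto_const)
      (auto intro!: eventually_mono[OF eventually_at_right_less])
  then have "((\<lambda>r. g r * B powr p) \<longlongrightarrow> 0) (at_right 0)" by (simp add: g_def)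
  then have "\<forall>\<^sub>F r in at_right 0. g r * B powr p < A - q"
    by (rule order_tendstoD) (use q in simp)
  moreover have "\<forall>\<^sub>F r in at_right 0. r < t2 - t1"
    using t2 by (intro eventually_at_rightI[of 0 "t2 - t1"]) auto
  moreover have "\<forall>\<^sub>F r in at_right (0::real). 0 < r"
    by (rule eventually_at_right_less)
  ultimately have "\<forall>\<^sub>F r in at_right 0. g r * B powr p < A - q \<and> r < t2 - t1 \<and> 0 < r"
    by eventually_elim auto
  then obtain r where r: "g r * B powr p < A - q" "r < t2 - t1" "0 < r"
    using eventually_happens'[OF trivial_limit_at_right_real] by blast
  obtain t where t: "t \<in> E" "t < t1 + r"
    using cInf_lessD[of E "t1 + r"] t' r by (auto simp: t1_def)
  have "t1 \<le> t" unfolding t1_def using t bddE by (intro cInf_lower)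
  obtain x where x: "2 * A < U (x, t)" "t0 < t" "t < T" using t by (auto simp: E_def)
  have "U (x, t) \<le> A + q + g (t - t1) * B powr p"
    using \<open>t1 \<le> t\<close> t1 x t r by (intro step before B) auto
  also have "g (t - t1) \<le> g r"
    unfolding g_def using \<sigma> Gamma_pos t \<open>t1 \<le> t\<close> by (intro divide_right_mono powr_mono2) auto
  then have "A + q + g (t - t1) * B powr p \<le> A + q + g r * B powr p"
    by (intro add_left_mono mult_right_mono) auto
  finally show False using r x by linarith
qed

end

section \<open>Upper rate\<close>

text \<open>At age \<open>r\<close> the region is a ball of radius \<open>sqrt r\<close>, whose
  volume cancels the weight up to \<open>1 / r\<close>; the remaining time integral is the logarithm
  that drives the argument in the Fujita range.\<close>

lemma nn_integral_paraboloid: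
  fixes x0 :: "real^'n"
  assumes ab: "0 < a" "a \<le> b"
  shows "(\<integral>\<^sup>+zs. ennreal ((snd zs - t0) powr (- real CARD('n) / 2 - 1))
      * (indicator {a..b} (snd zs - t0) * indicator {0..} (sqrt (snd zs - t0) - dist x0 (fst zs))) \<partial>lborel)
    = ennreal (unit_ball_vol (real CARD('n)) * ln (b / a))"
proof -
  let ?V = "unit_ball_vol (real CARD('n))"
  have V: "0 \<le> ?V" by simp
  have inner: "(\<integral>\<^sup>+z. ennreal (r powr (- real CARD('n) / 2 - 1))
      * (indicator {a..b} r * indicator {0..} (sqrt r - dist x0 z)) \<partial>lborel)
      = ennreal ?V * (ennreal (1 / r) * indicator {a..b} r)" for r
  proof (cases "r \<in> {a..b}")
    case True
    then have r: "0 < r" using ab by auto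
    have ind: "indicator {0..} (sqrt r - dist x0 z) = indicator (cball x0 (sqrt r)) z" for z
      by (auto simp: indicator_def)
    have "sqrt r ^ CARD('n) = r powr (real CARD('n) / 2)"
      using r by (simp add: powr_half_sqrt[symmetric] powr_powr flip: powr_realpow)
    then have "r powr (- real CARD('n) / 2 - 1) * (?V * sqrt r ^ CARD('n)) = ?V * (r powr (- real CARD('n) / 2 - 1) * r powr (real CARD('n) / 2))"
      by simp
    also have "\<dots> = ?V * (1 / r)"
      using r by (subst powr_add[symmetric]) (simp add: powr_minus field_simps)
    finally have eq: "r powr (- real CARD('n) / 2 - 1) * (?V * sqrt r ^ CARD('n)) = ?V * (1 / r)" .
    have "(\<integral>\<^sup>+z. ennreal (r powr (- real CARD('n) / 2 - 1))
        * (indicator {a..b} r * indicator {0..} (sqrt r - dist x0 z)) \<partial>lborel)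
      = ennreal (r powr (- real CARD('n) / 2 - 1)) * emeasure lborel (cball x0 (sqrt r))"
      using True unfolding ind by (simp add: nn_integral_cmult_indicator)
    also have "\<dots> = ennreal (r powr (- real CARD('n) / 2 - 1) * (?V * sqrt r ^ CARD('n)))"
      using r by (simp add: emeasure_cball ennreal_mult)
    also have "\<dots> = ennreal ?V * (ennreal (1 / r) * indicator {a..b} r)"
      unfolding eq using True r V by (simp add: ennreal_mult[symmetric])
    finally show ?thesis .
  qed simp
  have "(\<integral>\<^sup>+zs. ennreal ((snd zs - t0) powr (- real CARD('n) / 2 - 1))
      * (indicator {a..b} (snd zs - t0) * indicator {0..} (sqrt (snd zs - t0) - dist x0 (fst zs))) \<partial>lborel)
    = (\<integral>\<^sup>+s. ennreal ?V * (ennreal (1 / (s - t0)) * indicator {a..b} (s - t0)) \<partial>lborel)"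
    by (subst nn_integral_pair_lborel) (measurable, simp only: inner fst_conv snd_conv)
  also have "\<dots> = (\<integral>\<^sup>+r. ennreal ?V * (ennreal (1 / r) * indicator {a..b} r) \<partial>lborel)"
    by (subst nn_integral_real_affine[of _ 1 t0]) auto
  also have "\<dots> = ennreal ?V * ennreal (ln b - ln a)"
    using ab by (subst nn_integral_cmult) (auto intro!: arg_cong2[where f="(*)"] nn_integral_FTC_Icc derivative_eq_intros)
  also have "\<dots> = ennreal (?V * ln (b / a))"
    using ab V by (simp add: ennreal_mult[symmetric] ln_div)
  finally show ?thesis .
qed

context mild_solution
begin

text \<open>The choice of \<open>a\<close> makes the last time interval of length \<open>a\<close> contribute at most \<open>m / 4\<close>
  to the potential; the remaining past spreads by the Harnack inequality for \<open>G\<close>.\<close>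

lemma spreading:
  fixes x0 :: "real^'n"
  assumes t0: "0 < t0" "t0 < T" and m: "m \<le> U (x0, t0)" "4 * C \<le> m" "0 < m"
    and half: "\<And>z s. s \<le> t0 \<Longrightarrow> U (z, s) \<le> 2 * m"
    and a: "0 < a" "a powr \<sigma> / (\<sigma> * Gamma \<sigma>) * (2 * m) powr p \<le> m / 4"
    and r: "a \<le> r" "t0 + r < T" and z: "dist x0 z \<le> sqrt r"
  shows "m / 2 * exp (- 1 / 4) * (2 * r / a) powr (\<sigma> - 1 - real CARD('n) / 2) - C \<le> U (z, t0 + r)"
proof -
  let ?W = "\<lambda>zs. ennreal (U zs powr p)"
  let ?w = "\<lambda>zs. ?W zs * indicator {..t0 - a} (snd zs)"
  let ?b = "\<sigma> - 1 - real CARD('n) / 2"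
  have r0: "0 < r" using a r by simp
  have "pot \<sigma> ?W x0 t0 \<le> pot \<sigma> (\<lambda>zs. ?w zs + ennreal ((2 * m) powr p) * indicator {t0 - a..} (snd zs)) x0 t0"
  proof (intro pot_mono)
    fix z :: "real^'n" and s assume "s < t0"
    then have "?W (z, s) \<le> ennreal ((2 * m) powr p)"
      using p nonneg half[of s z] by (intro ennreal_leI powr_mono2) auto
    then show "?W (z, s) \<le> ?w (z, s) + ennreal ((2 * m) powr p) * indicator {t0 - a..} (snd (z, s))"
      by (auto simp: indicator_def)
  qed (use \<sigma> in simp)
  also have "\<dots> = pot \<sigma> ?w x0 t0 + ennreal ((2 * m) powr p) * ennreal (a powr \<sigma> / (\<sigma> * Gamma \<sigma>))"
    using \<sigma> a by (subst pot_add) (simp_all add: pot_indicator)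
  also have "\<dots> = pot \<sigma> ?w x0 t0 + ennreal (a powr \<sigma> / (\<sigma> * Gamma \<sigma>) * (2 * m) powr p)"
    using \<sigma> by (simp add: ennreal_mult[symmetric] mult_ac)
  also have "\<dots> \<le> pot \<sigma> ?w x0 t0 + ennreal (m / 4)"
    using a by (intro add_left_mono ennreal_leI)
  finally have P: "pot \<sigma> ?W x0 t0 \<le> pot \<sigma> ?w x0 t0 + ennreal (m / 4)" .
  \<comment> \<open>Of the value \<open>m\<close>, the datum accounts for at most
    \<open>C \<le> m / 4\<close> and the recent source for another \<open>m / 4\<close>, so half of
    it comes from before \<open>t0 - a\<close>.\<close>
  have "ennreal m \<le> ennreal (U (x0, t0))" using m by (intro ennreal_leI)
  also have "\<dots> \<le> pot \<sigma> ?W x0 t0 + ennreal C" using t0 by (rule upper)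
  also have "\<dots> \<le> (pot \<sigma> ?w x0 t0 + ennreal (m / 4)) + ennreal (m / 4)"
    using P m by (intro add_mono ennreal_leI) auto
  also have "\<dots> = pot \<sigma> ?w x0 t0 + ennreal (m / 2)"
    using m by (simp add: add.assoc ennreal_plus[symmetric] del: ennreal_plus)
  also have "ennreal m = ennreal (m / 2) + ennreal (m / 2)"
    using m by (simp add: ennreal_plus[symmetric] del: ennreal_plus)
  also have "pot \<sigma> ?w x0 t0 + ennreal (m / 2) = ennreal (m / 2) + pot \<sigma> ?w x0 t0"
    by (rule add.commute)
  finally have past: "ennreal (m / 2) \<le> pot \<sigma> ?w x0 t0"
    by (simp add: ennreal_add_left_cancel_le)
  have "norm (z - x0) \<le> sqrt r" using z by (simp add: dist_norm norm_minus_commute)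
  then have "(norm (z - x0))\<^sup>2 \<le> r" using r0 by (metis norm_ge_zero power_mono real_sqrt_pow2 less_imp_le)
  then have E: "exp (- 1 / 4) \<le> exp (- (norm (z - x0))\<^sup>2 / (4 * r))"
    using r0 by (simp add: divide_simps)
  have "exp (- 1 / 4) * (2 * r / a) powr ?b \<le> (1 + r / a) powr ?b * exp (- (norm (z - x0))\<^sup>2 / (4 * r))"
  proof -
    \<comment> \<open>Here \<open>r \<ge> a\<close> gives \<open>1 + r / a \<le> 2 * r / a\<close>,
      and \<open>?b\<close> is negative.\<close>
    have "(2 * r / a) powr ?b \<le> (1 + r / a) powr ?b"
      using a r r0 \<sigma> by (intro powr_mono2' add_pos_pos divide_pos_pos) (auto simp: field_simps)
    then show ?thesis using E by (subst mult.commute) (intro mult_mono, auto)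
  qed
  then have "ennreal (exp (- 1 / 4) * (2 * r / a) powr ?b) * ennreal (m / 2)
    \<le> ennreal ((1 + r / a) powr ?b * exp (- (norm (z - x0))\<^sup>2 / (4 * r))) * pot \<sigma> ?w x0 t0"
    by (intro mult_mono[OF ennreal_leI past]) auto
  also have "\<dots> \<le> pot \<sigma> ?w (x0 + (z - x0)) (t0 + r)"
    using \<sigma> a r0 by (intro pot_Harnack) auto
  also have "\<dots> \<le> pot \<sigma> ?W z (t0 + r)"
    using \<sigma> by (simp add: pot_mono indicator_def)
  also have "\<dots> \<le> ennreal (U (z, t0 + r) + C)"
    using t0 r r0 by (intro lower) auto
  finally have "ennreal (exp (- 1 / 4) * (2 * r / a) powr ?b) * ennreal (m / 2) \<le> ennreal (U (z, t0 + r) + C)" .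
  then have "ennreal (exp (- 1 / 4) * (2 * r / a) powr ?b * (m / 2)) \<le> ennreal (U (z, t0 + r) + C)"
    using m by (subst ennreal_mult) auto
  then have "exp (- 1 / 4) * (2 * r / a) powr ?b * (m / 2) \<le> U (z, t0 + r) + C"
    using C nonneg[of "(z, t0 + r)"] by (subst (asm) ennreal_le_iff) auto
  then show ?thesis by (simp add: mult_ac)
qed

text \<open>On the paraboloid of ages between \<open>a\<close> and \<open>K / 2\<close> the Gaussian
  weight is at least \<open>exp (- 1 / 4)\<close> times its peak, and the remaining time is at least
  \<open>K / 2\<close>. The decay assumed for \<open>U\<close>, raised to the power
  \<open>p\<close>, is no faster than the weight of \<open>nn_integral_paraboloid\<close>.\<close>

lemma spreading_mass:
  fixes x0 :: "real^'n"
  assumes K: "0 < a" "2 * a \<le> K" "t0 + K < T" and k: "0 \<le> k" and h: "0 \<le> h"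
    and crit: "b * p \<le> real CARD('n) / 2 + 1"
    and U: "\<And>z r. a \<le> r \<Longrightarrow> r \<le> K / 2 \<Longrightarrow> dist x0 z \<le> sqrt r \<Longrightarrow> h * (r / a) powr (- b) \<le> U (z, t0 + r)"
  shows "ennreal ((4 * pi * K) powr (- real CARD('n) / 2) * exp (- 1 / 4) * (h * (K / 2) powr k) powr p
      * a powr (real CARD('n) / 2 + 1) * (unit_ball_vol (real CARD('n)) * ln (K / (2 * a))))
    \<le> (\<integral>\<^sup>+zs. ennreal (heatK K (fst zs - x0) * (U zs * (t0 + K - snd zs) powr k) powr p) * indicator {t0<..<t0 + K} (snd zs) \<partial>lborel)"
proof -
  let ?n = "real CARD('n)"
  define c where "c = (4 * pi * K) powr (- ?n / 2) * exp (- 1 / 4) * (h * (K / 2) powr k) powr p * a powr (?n / 2 + 1)"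
  have c0: "0 \<le> c" by (simp add: c_def)
  have K0: "0 < K" using K by simp
  have "ennreal (c * (unit_ball_vol ?n * ln (K / (2 * a)))) = ennreal c * ennreal (unit_ball_vol ?n * ln ((K / 2) / a))"
    using c0 K by (simp add: ennreal_mult)
  also have "ennreal (unit_ball_vol ?n * ln ((K / 2) / a)) = (\<integral>\<^sup>+zs. ennreal ((snd zs - t0) powr (- ?n / 2 - 1))
      * (indicator {a..K / 2} (snd zs - t0) * indicator {0..} (sqrt (snd zs - t0) - dist x0 (fst zs))) \<partial>lborel)"
    using K by (intro nn_integral_paraboloid[symmetric]) auto
  also have "ennreal c * (\<integral>\<^sup>+zs. ennreal ((snd zs - t0) powr (- ?n / 2 - 1))
      * (indicator {a..K / 2} (snd zs - t0) * indicator {0..} (sqrt (snd zs - t0) - dist x0 (fst zs))) \<partial>lborel) = (\<integral>\<^sup>+zs. ennreal c * (ennreal ((snd zs - t0) powr (- ?n / 2 - 1))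
      * (indicator {a..K / 2} (snd zs - t0) * indicator {0..} (sqrt (snd zs - t0) - dist x0 (fst zs)))) \<partial>lborel)"
    by (rule nn_integral_cmult[symmetric]) measurable
  also have "\<dots> \<le> (\<integral>\<^sup>+zs. ennreal (heatK K (fst zs - x0) * (U zs * (t0 + K - snd zs) powr k) powr p) * indicator {t0<..<t0 + K} (snd zs) \<partial>lborel)"
  proof (intro nn_integral_mono)
    fix zs :: "(real^'n) \<times> real"
    define r where "r = snd zs - t0"
    show "ennreal c * (ennreal ((snd zs - t0) powr (- ?n / 2 - 1))
        * (indicator {a..K / 2} (snd zs - t0) * indicator {0..} (sqrt (snd zs - t0) - dist x0 (fst zs))))
      \<le> ennreal (heatK K (fst zs - x0) * (U zs * (t0 + K - snd zs) powr k) powr p) * indicator {t0<..<t0 + K} (snd zs)"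
    proof (cases "a \<le> r \<and> r \<le> K / 2 \<and> dist x0 (fst zs) \<le> sqrt r")
      case True
      then have r: "a \<le> r" "r \<le> K / 2" "dist x0 (fst zs) \<le> sqrt r" "0 < r" using K by auto
      have zs: "zs = (fst zs, t0 + r)" by (simp add: r_def)
      have "norm (fst zs - x0) \<le> sqrt r" using r by (simp add: dist_norm norm_minus_commute)
      then have "(norm (fst zs - x0))\<^sup>2 \<le> r" using r by (metis norm_ge_zero power_mono real_sqrt_pow2 less_imp_le)
      then have "(4 * pi * K) powr (- ?n / 2) * exp (- 1 / 4) \<le> heatK K (fst zs - x0)"
        unfolding heatK_def using r K0 by (intro mult_left_mono) (auto simp: divide_simps)
      moreover have "(h * (K / 2) powr k) powr p * (a powr (?n / 2 + 1) * r powr (- ?n / 2 - 1)) \<le> (U zs * (t0 + K - snd zs) powr k) powr p"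
      proof -
        have q: "- ?n / 2 - 1 = - (?n / 2 + 1)" by simp
        have "a powr (?n / 2 + 1) * r powr (- ?n / 2 - 1) = (r / a) powr (- (?n / 2 + 1))"
          unfolding q using r K by (simp add: powr_divide powr_minus field_simps)
        also have "\<dots> \<le> (r / a) powr (- (b * p))"
          using r K crit by (intro powr_mono) auto
        finally have "(h * (K / 2) powr k) powr p * (a powr (?n / 2 + 1) * r powr (- ?n / 2 - 1))
          \<le> (h * (K / 2) powr k) powr p * (r / a) powr (- (b * p))"
          by (intro mult_left_mono) auto
        also have "\<dots> = (h * (r / a) powr (- b) * (K / 2) powr k) powr p"
          using h r K0 by (simp only: powr_mult powr_powr) (simp add: mult_ac)
        also have "\<dots> \<le> (U zs * (t0 + K - snd zs) powr k) powr p"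
        proof (intro powr_mono2 mult_mono)
          show "h * (r / a) powr - b \<le> U zs" using U[of r "fst zs"] r by (subst zs) auto
          show "K / 2 \<le> t0 + K - snd zs" using r by (simp add: r_def)
        qed (use p h k K0 nonneg in auto)
        finally show ?thesis .
      qed
      ultimately have "((4 * pi * K) powr (- ?n / 2) * exp (- 1 / 4)) * ((h * (K / 2) powr k) powr p * (a powr (?n / 2 + 1) * r powr (- ?n / 2 - 1)))
        \<le> heatK K (fst zs - x0) * (U zs * (t0 + K - snd zs) powr k) powr p"
        by (intro mult_mono) auto
      then have "c * r powr (- ?n / 2 - 1) \<le> heatK K (fst zs - x0) * (U zs * (t0 + K - snd zs) powr k) powr p"
        by (simp add: c_def mult_ac)
      moreover have "snd zs \<in> {t0<..<t0 + K}" using r K0 by (auto simp: r_def)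
      ultimately show ?thesis using c0 True
        by (simp add: r_def[symmetric] ennreal_mult[symmetric] ennreal_leI)
    next
      case False
      then have "indicator {a..K / 2} r * indicator {0..} (sqrt r - dist x0 (fst zs)) = (0::ennreal)"
        by (auto simp: indicator_def)
      then show ?thesis unfolding r_def by (simp only: mult_zero_right zero_le)
    qed
  qed
  finally show ?thesis by (simp add: c_def mult_ac)
qed

end

section \<open>Remaining life span after a large value\<close>

context mild_solution
begin

text \<open>If \<open>U\<close> lived beyond \<open>t0 + \<rho> * a\<close>, the Gaussian test would
  bound the weighted mass by \<open>P * Q * K\<close>, while spreading gives at least
  \<open>P * K * ln (\<rho> / 2)\<close>. The constants depend on neither \<open>x0\<close> nor
  \<open>t0\<close> nor the value \<open>m\<close>, so one \<open>\<rho>\<close> excludes this for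
  all large values.\<close>

lemma lifespan_bound:
  defines "k \<equiv> \<sigma> / (p - 1)"
  assumes crit: "p \<le> 1 + 2 * \<sigma> / (real CARD('n) + 2 * (1 - \<sigma>))"
  obtains L m0 where "0 < L" "0 < m0"
    "\<And>(x0::real^'n) t0. 0 < t0 \<Longrightarrow> t0 < T \<Longrightarrow> m0 \<le> U (x0, t0) \<Longrightarrow>
      (\<And>z s. s \<le> t0 \<Longrightarrow> U (z, s) \<le> 2 * U (x0, t0)) \<Longrightarrow> T - t0 \<le> L * U (x0, t0) powr (- 1 / k)"
proof -
  let ?n = "real CARD('n)"
  define b where "b = ?n / 2 + 1 - \<sigma>"
  have b: "0 < b" using \<sigma> by (simp add: b_def add_pos_pos)
  \<comment> \<open>The Fujita condition in terms of the decay exponent \<open>b\<close>. It yields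
    integrability at worst logarithmic (\<open>bp\<close>) and the scaling inequality
    \<open>kb\<close>.\<close>
  have "(p - 1) * b \<le> \<sigma>" using crit b unfolding b_def by (simp add: field_simps)
  then have bp: "b * p \<le> ?n / 2 + 1" and kb: "b \<le> k"
    using p by (auto simp: b_def k_def field_simps)
  have k: "0 < k" "k * p = k + \<sigma>" using \<sigma> p by (auto simp: k_def field_simps)
  have kp: "1 \<le> k * p - ?n / 2" using kb unfolding k(2) b_def by simp
  define c where "c = 2 powr (- ?n / 2 - k - \<sigma>) / (\<sigma> * Gamma \<sigma>)"
  define C1 where "C1 = (2 / c) powr (1 / (p - 1))"
  \<comment> \<open>With \<open>a = \<delta> * m powr (- 1 / k)\<close> this value makes the
    contribution of a time interval of length \<open>a\<close> equal to \<open>m / 4\<close>, as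
    \<open>spreading\<close> requires.\<close>
  define \<delta> where "\<delta> = (\<sigma> * Gamma \<sigma> / (4 * 2 powr p)) powr (1 / \<sigma>)"
  \<comment> \<open>Half of the constant delivered by \<open>spreading\<close>; the other half
    absorbs the loss \<open>C\<close>.\<close>
  define c3 where "c3 = exp (- 1 / 4) * 2 powr (- b) / 4"
  define P where "P = (4 * pi) powr (- ?n / 2) * exp (- 1 / 4) * (c3 * (\<delta> / 2) powr k) powr p * unit_ball_vol ?n"
  define Q where "Q = 2 / c * (C1 + 1) / P"
  \<comment> \<open>Chosen so that \<open>ln (\<rho> / 2) = Q + 1\<close> exceeds \<open>Q\<close>,
    the ratio of the constants in the upper and lower bounds.\<close>
  define \<rho> where "\<rho> = 2 * exp (Q + 1)"
  \<comment> \<open>The summands ensure positivity, the hypothesis \<open>4 * C \<le> m\<close> of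
    \<open>spreading\<close>, absorption of \<open>C\<close> for all ages up to
    \<open>\<rho> * a\<close>, and \<open>C * K powr k \<le> 1\<close>.\<close>
  define m0 where "m0 = 1 + 4 * C + C * \<rho> powr b / c3 + C * (\<rho> * \<delta>) powr k"
  have c: "0 < c" using \<sigma> by (simp add: c_def)
  have C1: "0 < C1" using c by (simp add: C1_def)
  have d: "0 < \<delta>" using \<sigma> less_imp_neq[OF Gamma_pos] by (simp add: \<delta>_def)
  have dpow: "\<delta> powr \<sigma> = \<sigma> * Gamma \<sigma> / (4 * 2 powr p)" using \<sigma> by (simp add: \<delta>_def powr_powr)
  have c3: "0 < c3" by (simp add: c3_def)
  have P: "0 < P" using c3 d by (simp add: P_def)
  have Q: "0 < Q" using c C1 P by (simp add: Q_def add_pos_pos)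
  have rho: "2 \<le> \<rho>" "0 < \<rho>" using Q by (auto simp: \<rho>_def)
  have m0pos: "0 < m0" using C c3 by (simp add: m0_def add_pos_nonneg)
  show thesis
  proof (rule that[of "\<rho> * \<delta>" m0])
    show "0 < \<rho> * \<delta>" using rho d by simp
    show "0 < m0" by (rule m0pos)
    fix x0 :: "real^'n" and t0
    assume t0: "0 < t0" "t0 < T" and m_ge: "m0 \<le> U (x0, t0)"
      and half: "\<And>z s. s \<le> t0 \<Longrightarrow> U (z, s) \<le> 2 * U (x0, t0)"
    define m where "m = U (x0, t0)"
    have m: "0 < m" "4 * C \<le> m" "C * \<rho> powr b / c3 \<le> m" "C * (\<rho> * \<delta>) powr k \<le> m"
    proof -
      have nn: "0 \<le> C * \<rho> powr b / c3" "0 \<le> C * (\<rho> * \<delta>) powr k" using C c3 by auto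
      show "0 < m" using m0pos m_ge by (simp add: m_def)
      show "4 * C \<le> m" "C * \<rho> powr b / c3 \<le> m" "C * (\<rho> * \<delta>) powr k \<le> m"
        using m_ge nn C unfolding m_def m0_def by linarith+
    qed
    define a where "a = \<delta> * m powr (- 1 / k)"
    define K where "K = \<rho> * a"
    have a: "0 < a" using d m by (simp add: a_def)
    have K: "0 < K" "2 * a \<le> K" using a rho by (auto simp: K_def)
    have "(m powr (- 1 / k)) powr k = 1 / m"
      using k m by (subst powr_powr) (simp add: powr_minus_divide)
    then have ak: "a powr k = \<delta> powr k / m"
      by (simp add: a_def powr_mult)
    have "T - t0 \<le> K"
    proof (rule ccontr)
      assume "\<not> T - t0 \<le> K"
      then have KT: "t0 + K < T" by simp
      have sk: "\<sigma> / k = p - 1" using \<sigma> p by (simp add: k_def)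
      have "a powr \<sigma> = \<delta> powr \<sigma> * m powr (- (\<sigma> / k))"
        using m d by (simp add: a_def powr_mult powr_powr)
      also have "\<dots> = \<sigma> * Gamma \<sigma> / (4 * 2 powr p) * m powr (1 - p)"
        unfolding dpow sk by simp
      finally have "a powr \<sigma> / (\<sigma> * Gamma \<sigma>) * (2 * m) powr p = m powr (1 - p) * m powr p / 4"
        using \<sigma> less_imp_neq[OF Gamma_pos] m by (simp add: powr_mult)
      also have "m powr (1 - p) * m powr p = m" using m by (subst powr_add[symmetric]) simp
      finally have small: "a powr \<sigma> / (\<sigma> * Gamma \<sigma>) * (2 * m) powr p \<le> m / 4" by simp
      have low: "c3 * m * (r / a) powr (- b) \<le> U (z, t0 + r)"
        if r: "a \<le> r" "r \<le> K / 2" "dist x0 z \<le> sqrt r" for z r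
      proof -
        have "m / 2 * exp (- 1 / 4) * (2 * r / a) powr (\<sigma> - 1 - ?n / 2) - C \<le> U (z, t0 + r)"
          using r KT K t0 half m small a
          by (intro spreading[where ?x0.0=x0 and m=m]) (auto simp: m_def)
        moreover have "(2 * r / a) powr (\<sigma> - 1 - ?n / 2) = 2 powr (- b) * (r / a) powr (- b)"
          using r a by (simp add: b_def algebra_simps flip: powr_mult)
        then have "m / 2 * exp (- 1 / 4) * (2 * r / a) powr (\<sigma> - 1 - ?n / 2) = 2 * (c3 * m * (r / a) powr (- b))"
          by (simp add: c3_def)
        moreover have "C \<le> c3 * m * (r / a) powr (- b)"
        proof -
          have "r / a \<le> \<rho>" using r a K by (simp add: K_def field_simps)
          then have "\<rho> powr (- b) \<le> (r / a) powr (- b)" using r a b by (intro powr_mono2') auto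
          then have "c3 * m * \<rho> powr (- b) \<le> c3 * m * (r / a) powr (- b)"
            using c3 m by (intro mult_left_mono) auto
          moreover have "C \<le> c3 * m * \<rho> powr (- b)"
            using m(3) c3 rho by (simp add: powr_minus field_simps)
          ultimately show ?thesis by linarith
        qed
        ultimately show ?thesis by linarith
      qed
      have "ennreal ((4 * pi * K) powr (- ?n / 2) * exp (- 1 / 4) * (c3 * m * (K / 2) powr k) powr p
          * a powr (?n / 2 + 1) * (unit_ball_vol ?n * ln (K / (2 * a))))
        \<le> ennreal (2 / c * (C1 * K + C * K powr (k + 1)))"
      proof (rule order_trans[OF spreading_mass[where ?x0.0=x0 and ?t0.0=t0 and b=b]])
        show "(\<integral>\<^sup>+zs. ennreal (heatK K (fst zs - x0) * (U zs * (t0 + K - snd zs) powr k) powr p) * indicator {t0<..<t0 + K} (snd zs) \<partial>lborel)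
          \<le> ennreal (2 / c * (C1 * K + C * K powr (k + 1)))"
          using test_function_bound[of K "t0 + K" x0, folded k_def, folded c_def, folded C1_def] K KT t0
          by simp
      qed (use a K KT k bp low c3 m in auto)
      then have main: "(4 * pi * K) powr (- ?n / 2) * exp (- 1 / 4) * (c3 * m * (K / 2) powr k) powr p
          * a powr (?n / 2 + 1) * (unit_ball_vol ?n * ln (K / (2 * a)))
        \<le> 2 / c * (C1 * K + C * K powr (k + 1))"
        using c C1 C K by (subst (asm) ennreal_le_iff) auto
      \<comment> \<open>Scaling: \<open>a powr k\<close> is proportional to \<open>1 / m\<close>, so
        \<open>m\<close> cancels and only \<open>\<rho>\<close> and \<open>\<delta>\<close>
        remain.\<close>
      have e1: "c3 * m * (K / 2) powr k = c3 * (\<delta> / 2) powr k * \<rho> powr k"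
        using rho a d m ak by (simp add: K_def powr_mult powr_divide)
      have e2: "(c3 * m * (K / 2) powr k) powr p = (c3 * (\<delta> / 2) powr k) powr p * \<rho> powr (k * p)"
        unfolding e1 by (simp add: powr_mult powr_powr)
      have e3: "(4 * pi * K) powr (- ?n / 2) = (4 * pi) powr (- ?n / 2) * \<rho> powr (- ?n / 2) * a powr (- ?n / 2)"
        by (simp add: K_def powr_mult)
      have e4: "a powr (- ?n / 2) * a powr (?n / 2 + 1) = a"
        using a by (subst powr_add[symmetric]) simp
      have e5: "\<rho> powr (k * p) * \<rho> powr (- ?n / 2) = \<rho> powr (k * p - ?n / 2)"
        by (simp add: powr_add[symmetric])
      have e6: "ln (K / (2 * a)) = Q + 1" using a by (simp add: K_def \<rho>_def)
      have "(4 * pi * K) powr (- ?n / 2) * exp (- 1 / 4) * (c3 * m * (K / 2) powr k) powr p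
          * a powr (?n / 2 + 1) * (unit_ball_vol ?n * ln (K / (2 * a)))
        = P * (\<rho> powr (k * p) * \<rho> powr (- ?n / 2)) * (a powr (- ?n / 2) * a powr (?n / 2 + 1)) * (Q + 1)"
        unfolding e2 e3 e6 P_def by (simp only: mult_ac)
      also have "\<dots> = P * \<rho> powr (k * p - ?n / 2) * a * (Q + 1)"
        unfolding e4 e5 ..
      finally have lhs: "P * \<rho> powr (k * p - ?n / 2) * a * (Q + 1) \<le> 2 / c * (C1 * K + C * K powr (k + 1))"
        using main by simp
      \<comment> \<open>By \<open>kp\<close> the lower bound carries at least one full power of
        \<open>\<rho>\<close>, which turns \<open>a\<close> into \<open>K\<close> and matches the
        upper bound.\<close>
      have "\<rho> powr 1 \<le> \<rho> powr (k * p - ?n / 2)" using kp rho by (intro powr_mono) auto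
      then have "P * \<rho> * a * (Q + 1) \<le> P * \<rho> powr (k * p - ?n / 2) * a * (Q + 1)"
        using P Q a rho by (intro mult_right_mono mult_left_mono) auto
      also note lhs
      also have "C * K powr (k + 1) \<le> K"
      proof -
        have "C * K powr k = C * (\<rho> * \<delta>) powr k / m"
          using ak by (simp add: K_def powr_mult)
        also have "\<dots> \<le> 1" using m by (simp add: divide_simps)
        finally have "C * K powr k * K \<le> 1 * K" using K by (intro mult_right_mono) auto
        then show ?thesis using K by (simp add: powr_add mult_ac)
      qed
      then have "2 / c * (C1 * K + C * K powr (k + 1)) \<le> 2 / c * (C1 * K + K)"
        using c by (intro mult_left_mono add_left_mono) auto
      also have "\<dots> = P * Q * K" using P c by (simp add: Q_def field_simps)
      finally have "P * K * (Q + 1) \<le> P * K * Q" by (simp add: K_def mult_ac)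
      then show False using P K by simp
    qed
    then show "T - t0 \<le> \<rho> * \<delta> * U (x0, t0) powr (- 1 / k)"
      by (simp add: K_def a_def m_def mult_ac)
  qed
qed

section \<open>Combination of the two rates\<close>

lemma bdd_above_slice: "t < T \<Longrightarrow> bdd_above (range (\<lambda>x. U (x, t)))"
  using bdd by (meson bdd_above.I2 order_refl)

text \<open>The lower rate is \<open>growth_lower_bound\<close> at each time close to
  \<open>T\<close>, solved for the supremum. For the upper rate, a point of the past carrying more
  than half of the past supremum is fed into \<open>lifespan_bound\<close>.\<close>

lemma blowup_rate:
  assumes crit: "p \<le> 1 + 2 * \<sigma> / (real CARD('n) + 2 * (1 - \<sigma>))"
    and blowup: "filterlim (\<lambda>t. SUP x. U (x, t)) at_top (at_left T)"
  shows "\<exists>c1 c2. 0 < c1 \<and> c1 \<le> c2 \<and> (\<forall>\<^sub>F t in at_left T.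
    c1 * (T - t) powr (- \<sigma> / (p - 1)) \<le> (SUP x. U (x, t)) \<and>
    (SUP x. U (x, t)) \<le> c2 * (T - t) powr (- \<sigma> / (p - 1)))"
proof -
  define S where "S = (\<lambda>t. SUP x. U (x, t))"
  define k where "k = \<sigma> / (p - 1)"
  have k: "0 < k" using \<sigma> p by (simp add: k_def)
  have US: "U (x, t) \<le> S t" if "t < T" for x t
    unfolding S_def by (rule cSUP_upper[OF _ bdd_above_slice]) (use that in auto)
  have near: "\<forall>\<^sub>F t in at_left T. 0 < t \<and> t < T"
    using eventually_at_left[OF T] T by auto
  have ev: "\<forall>\<^sub>F t in at_left T. B < S t" for B
    using blowup unfolding S_def filterlim_at_top_dense by blast

  define D where "D = 2 powr p / (\<sigma> * Gamma \<sigma>)"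
  define c1 where "c1 = D powr (- 1 / (p - 1)) / 2"
  have D: "0 < D" using \<sigma> less_imp_neq[OF Gamma_pos] by (simp add: D_def)
  have c1: "0 < c1" using D by (simp add: c1_def)
  have lower_rate: "\<forall>\<^sub>F t in at_left T. c1 * (T - t) powr (- k) \<le> S t"
    using ev[of "2 * C"] near
  proof eventually_elim
    case (elim t0)
    define A where "A = S t0 + 2 * C"
    \<comment> \<open>Close to \<open>T\<close> the supremum exceeds \<open>2 * C\<close>, so the
      datum costs only a factor two.\<close>
    have A: "0 < A" "A \<le> 2 * S t0" using elim C by (auto simp: A_def)
    have unb: "\<exists>x t. t0 < t \<and> t < T \<and> B < U (x, t)" for B
    proof -
      have "\<forall>\<^sub>F t in at_left T. t0 < t \<and> t < T"
        using eventually_at_left[of t0 T] elim by auto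
      with ev[of B] have "\<forall>\<^sub>F t in at_left T. B < S t \<and> t0 < t \<and> t < T"
        by eventually_elim auto
      then obtain t where t: "B < S t" "t0 < t" "t < T"
        using eventually_happens'[OF trivial_limit_at_left_real] by blast
      then have "\<exists>x. B < U (x, t)"
        using less_cSUP_iff[OF _ bdd_above_slice[OF t(3)], of B] by (auto simp: S_def)
      then show ?thesis using t by blast
    qed
    have "A \<le> (T - t0) powr \<sigma> / (\<sigma> * Gamma \<sigma>) * (2 * A) powr p"
      unfolding A_def using elim US unb A by (intro growth_lower_bound) (auto simp: A_def)
    also have "\<dots> = D * (T - t0) powr \<sigma> * A powr (p - 1) * A"
      using A by (simp add: D_def powr_mult powr_diff)
    finally have "1 \<le> D * (T - t0) powr \<sigma> * A powr (p - 1)"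
      using A by simp
    then have "1 powr (1 / (p - 1)) \<le> (D * (T - t0) powr \<sigma> * A powr (p - 1)) powr (1 / (p - 1))"
      using p by (intro powr_mono2) auto
    also have "\<dots> = D powr (1 / (p - 1)) * (T - t0) powr k * A"
      using p A by (simp add: powr_mult powr_powr k_def)
    also have "\<dots> \<le> D powr (1 / (p - 1)) * (T - t0) powr k * (2 * S t0)"
      using A by (intro mult_left_mono) auto
    finally show ?case
      using D elim by (simp add: c1_def powr_minus field_simps)
  qed

  obtain L m0 where L: "0 < L" and m0: "0 < m0"
    and life: "\<And>(x0::real^'n) t0. 0 < t0 \<Longrightarrow> t0 < T \<Longrightarrow> m0 \<le> U (x0, t0) \<Longrightarrow>
      (\<And>z s. s \<le> t0 \<Longrightarrow> U (z, s) \<le> 2 * U (x0, t0)) \<Longrightarrow> T - t0 \<le> L * U (x0, t0) powr (- 1 / k)"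
    using lifespan_bound[OF crit] unfolding k_def by blast
  have upper_rate: "\<forall>\<^sub>F t in at_left T. S t \<le> 2 * L powr k * (T - t) powr (- k)"
    using ev[of "2 * m0"] near
  proof eventually_elim
    case (elim t)
    let ?H = "{zs :: (real^'n) \<times> real. snd zs \<le> t}"
    \<comment> \<open>The supremum over the whole past, not over one slice: \<open>S\<close> need
      not be monotone, and \<open>lifespan_bound\<close> compares with all earlier times.\<close>
    define M where "M = (SUP zs\<in>?H. U zs)"
    have bddH: "bdd_above (U ` ?H)"
    proof -
      obtain B where "\<And>z s. s \<le> t \<Longrightarrow> U (z, s) \<le> B" using bdd elim by blast
      then show ?thesis by (intro bdd_aboveI2[of _ _ B]) auto
    qed
    have UM: "U (z, s) \<le> M" if "s \<le> t" for z s
      unfolding M_def by (rule cSUP_upper[OF _ bddH]) (use that in auto)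
    have SM: "S t \<le> M" unfolding S_def by (intro cSUP_least UM) auto
    have "M / 2 < M" using SM elim m0 by auto
    moreover have "?H \<noteq> {}" by (auto intro: exI[of _ t])
    ultimately obtain zs where zs: "snd zs \<le> t" "M / 2 < U zs"
      using less_cSUP_iff[OF _ bddH, of "M / 2"] unfolding M_def by auto
    obtain x0 t0 where x0: "zs = (x0, t0)" by (cases zs)
    define m where "m = U (x0, t0)"
    have m: "M < 2 * m" "m0 < m" using zs x0 SM elim by (auto simp: m_def)
    \<comment> \<open>The chosen time is positive because \<open>U\<close> vanishes at nonpositive
      times. It may precede \<open>t\<close>, which only helps, since
      \<open>T - t \<le> T - t0\<close>.\<close>
    have t0: "0 < t0" "t0 \<le> t" "t0 < T"
      using initial[of t0 x0] m m0 zs elim unfolding x0 m_def by (force simp: not_le[symmetric])+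
    have "T - t \<le> T - t0" using t0 by simp
    also have "\<dots> \<le> L * m powr (- 1 / k)"
      unfolding m_def
    proof (rule life)
      fix z s assume "s \<le> t0"
      then show "U (z, s) \<le> 2 * U (x0, t0)" using UM[of s z] t0 m by (simp add: m_def)
    qed (use t0 m in \<open>auto simp: m_def\<close>)
    finally have "(T - t) powr k \<le> (L * m powr (- 1 / k)) powr k"
      using elim k by (intro powr_mono2) auto
    also have "\<dots> = L powr k * m powr (- 1)"
      using k by (simp add: powr_mult powr_powr)
    also have "\<dots> = L powr k / m"
      using m m0 by (simp add: powr_minus_divide)
    finally have "m \<le> L powr k * (T - t) powr (- k)"
      using elim m m0 by (simp add: powr_minus field_simps)
    then show ?case using SM m by linarith
  qed
  define c2 where "c2 = max c1 (2 * L powr k)"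
  have "\<forall>\<^sub>F t in at_left T. c1 * (T - t) powr (- k) \<le> S t \<and> S t \<le> c2 * (T - t) powr (- k)"
    using lower_rate upper_rate
  proof eventually_elim
    case (elim t)
    have "2 * L powr k * (T - t) powr (- k) \<le> c2 * (T - t) powr (- k)"
      by (intro mult_right_mono) (auto simp: c2_def)
    then show ?case using elim by linarith
  qed
  moreover have "- \<sigma> / (p - 1) = - k" by (simp add: k_def)
  ultimately show ?thesis
    using c1 unfolding S_def by (intro exI[of _ c1] exI[of _ c2]) (auto simp: c2_def)
qed

end

section \<open>Contribution of the datum\<close>

text \<open>A function that is not integrable has Bochner integral \<open>0\<close>, so the bound
  needs no measurability. This matters because measurability of the datum is not assumed.\<close>

lemma abs_integral_le_nn_integral:
  fixes h :: "'a \<Rightarrow> real"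
  assumes "(\<integral>\<^sup>+x. ennreal \<bar>h x\<bar> \<partial>M) \<le> ennreal B" "0 \<le> B"
  shows "\<bar>integral\<^sup>L M h\<bar> \<le> B"
proof (cases "integrable M h")
  case True
  then have "ennreal \<bar>integral\<^sup>L M h\<bar> \<le> (\<integral>\<^sup>+x. ennreal \<bar>h x\<bar> \<partial>M)"
    using integral_norm_bound_ennreal[OF True] by (simp only: real_norm_def)
  then have "ennreal \<bar>integral\<^sup>L M h\<bar> \<le> ennreal B"
    using assms(1) by (rule order_trans)
  then show ?thesis using assms(2) by simp
qed (use assms in \<open>simp add: not_integrable_integral_eq\<close>)

lemma nn_integral_powr_to_inf:
  fixes e :: real
  assumes "e < -1"
  shows "(\<integral>\<^sup>+t. ennreal (t powr e) * indicator {1..} t \<partial>lborel) = ennreal (- 1 / (e + 1))"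
proof (rule nn_integral_has_integral_lebesgue')
  show "((\<lambda>t. t powr e) has_integral - 1 / (e + 1)) {1..}"
    using has_integral_powr_to_inf[OF assms, of 1] by simp
qed simp

text \<open>From \<open>ln y \<le> y - 1\<close> at \<open>y = (1 + r) / (8 q)\<close>.\<close>

lemma powr_le_exp:
  fixes q r :: real
  assumes "0 < q" "0 \<le> r"
  shows "(1 + r) powr q \<le> exp (1 / 8 + q * ln (8 * q)) * exp (r / 8)"
proof -
  have "ln ((1 + r) / (8 * q)) \<le> (1 + r) / (8 * q) - 1"
    using assms by (intro ln_le_minus_one) (auto intro!: divide_pos_pos)
  then have "q * ln ((1 + r) / (8 * q)) \<le> q * ((1 + r) / (8 * q))"
    using assms by (intro mult_left_mono) auto
  also have "q * ((1 + r) / (8 * q)) = (1 + r) / 8"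
    using assms by simp
  also have "ln ((1 + r) / (8 * q)) = ln (1 + r) - ln (8 * q)"
    using assms by (simp add: ln_div)
  finally have "q * ln (1 + r) \<le> (1 / 8 + q * ln (8 * q)) + r / 8"
    by (simp add: field_simps)
  then show ?thesis using assms by (simp add: powr_def exp_add[symmetric])
qed

text \<open>The power of \<open>1 + |y|^2 / t\<close> is absorbed by half of the Gaussian exponent,
  which turns \<open>heatK t\<close> into a multiple of \<open>heatK (2 * t)\<close>.\<close>

lemma parabolic_powr_heatK_le:
  fixes y :: "real^'n"
  assumes q: "0 < q" and t: "0 < t"
  shows "((norm y)\<^sup>2 + t) powr q * heatK t y
    \<le> exp (1 / 8 + q * ln (8 * q)) * 2 powr (real CARD('n) / 2) * t powr q * heatK (2 * t) y"
proof -
  let ?r = "(norm y)\<^sup>2 / t"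
  have "((norm y)\<^sup>2 + t) powr q = t powr q * (1 + ?r) powr q"
    using t by (simp add: distrib_left add.commute flip: powr_mult)
  also have "\<dots> \<le> t powr q * (exp (1 / 8 + q * ln (8 * q)) * exp (?r / 8))"
    using q t by (intro mult_left_mono powr_le_exp) auto
  finally have le: "((norm y)\<^sup>2 + t) powr q * heatK t y
    \<le> t powr q * (exp (1 / 8 + q * ln (8 * q)) * exp (?r / 8)) * heatK t y"
    by (intro mult_right_mono) auto
  have key: "exp (?r / 8) * heatK t y = 2 powr (real CARD('n) / 2) * heatK (2 * t) y"
  proof -
    have E: "exp (?r / 8) * exp (- (norm y)\<^sup>2 / (4 * t)) = exp (- (norm y)\<^sup>2 / (4 * (2 * t)))"
      using t by (simp add: exp_add[symmetric] field_simps)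
    have "2 powr (- real CARD('n) / 2) * (4 * pi * t) powr (- real CARD('n) / 2) = (4 * pi * (2 * t)) powr (- real CARD('n) / 2)"
      by (simp add: mult_ac flip: powr_mult)
    then have "2 powr (real CARD('n) / 2) * (4 * pi * (2 * t)) powr (- real CARD('n) / 2)
        = 2 powr (real CARD('n) / 2) * 2 powr (- real CARD('n) / 2) * (4 * pi * t) powr (- real CARD('n) / 2)"
      by (simp only: mult.assoc)
    also have "2 powr (real CARD('n) / 2) * 2 powr (- real CARD('n) / 2) = (1::real)"
      by (subst powr_add[symmetric]) simp
    finally have P: "(4 * pi * t) powr (- real CARD('n) / 2) = 2 powr (real CARD('n) / 2) * (4 * pi * (2 * t)) powr (- real CARD('n) / 2)"
      by (simp only: mult_1)
    have "exp (?r / 8) * heatK t y = (4 * pi * t) powr (- real CARD('n) / 2) * (exp (?r / 8) * exp (- (norm y)\<^sup>2 / (4 * t)))"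
      by (simp add: heatK_def)
    also have "\<dots> = 2 powr (real CARD('n) / 2) * heatK (2 * t) y"
      unfolding E P by (simp add: heatK_def)
    finally show ?thesis .
  qed
  have "t powr q * (exp (1 / 8 + q * ln (8 * q)) * exp (?r / 8)) * heatK t y
    = t powr q * (exp (1 / 8 + q * ln (8 * q)) * (exp (?r / 8) * heatK t y))"
    by (simp only: mult.assoc)
  also have "\<dots> = exp (1 / 8 + q * ln (8 * q)) * 2 powr (real CARD('n) / 2) * t powr q * heatK (2 * t) y"
    unfolding key by (simp only: mult_ac)
  finally show ?thesis using le by (simp only:)
qed

text \<open>For ages up to one, the Hoelder exponent improves the singularity of \<open>Lker\<close>
  to the integrable power \<open>\<epsilon> / 2 - 1\<close>. For larger ages, boundedness of
  \<open>f\<close> suffices because \<open>- 1 - \<sigma>\<close> is integrable at infinity.\<close>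

lemma Mop_bounded:
  fixes f :: "real^'n \<Rightarrow> real \<Rightarrow> real"
  assumes \<sigma>: "0 < \<sigma>" and \<epsilon>: "0 < \<epsilon>" and f: "hoelder_p (2 * \<sigma> + \<epsilon>) {(x, t). t \<le> 0} f"
  obtains D where "0 \<le> D" "\<And>x t. t \<le> 0 \<Longrightarrow> \<bar>Mop \<sigma> f x t\<bar> \<le> D"
proof -
  obtain B where "\<forall>(x, t)\<in>{(x, t). t \<le> 0}. \<bar>f x t\<bar> \<le> B"
    using f unfolding hoelder_p_def by blast
  then have B: "\<bar>f x t\<bar> \<le> B" if "t \<le> 0" for x t using that by auto
  have B0: "0 \<le> B" using B[of 0 0] by simp
  obtain H where "\<forall>(x, t)\<in>{(x, t). t \<le> 0}. \<forall>(z, s)\<in>{(x, t). t \<le> 0}.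
      \<bar>f x t - f z s\<bar> \<le> H * ((norm (x - z))\<^sup>2 + \<bar>t - s\<bar>) powr ((2 * \<sigma> + \<epsilon>) / 2)"
    using f unfolding hoelder_p_def by blast
  then have H: "\<bar>f x t - f z s\<bar> \<le> H * ((norm (x - z))\<^sup>2 + \<bar>t - s\<bar>) powr ((2 * \<sigma> + \<epsilon>) / 2)"
    if "t \<le> 0" "s \<le> 0" for x t z s using that by auto
  define q where "q = (2 * \<sigma> + \<epsilon>) / 2"
  have q: "0 < q" using \<sigma> \<epsilon> by (simp add: q_def)
  define E where "E = exp (1 / 8 + q * ln (8 * q)) * 2 powr (real CARD('n) / 2)"
  define A1 where "A1 = \<bar>H\<bar> * E / \<bar>Gamma (- \<sigma>)\<bar>"
  define A2 where "A2 = 2 * B / \<bar>Gamma (- \<sigma>)\<bar>"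
  have A: "0 \<le> A1" "0 \<le> A2" "0 \<le> E" using B0 by (auto simp: A1_def A2_def E_def)
  have bound: "\<bar>Mop \<sigma> f x t\<bar> \<le> A1 * (1 / (\<epsilon> / 2)) + A2 * (1 / \<sigma>)" if t: "t \<le> 0" for x t
    unfolding Mop_def
  proof (rule abs_integral_le_nn_integral)
    let ?g = "\<lambda>zs. ennreal (A1 * (t - snd zs) powr (\<epsilon> / 2 - 1)) * indicator {0<..1} (t - snd zs) * ennreal (heatK (2 * (t - snd zs)) (x - fst zs))
      + ennreal (A2 * (t - snd zs) powr (- 1 - \<sigma>)) * indicator {1<..} (t - snd zs) * ennreal (heatK (t - snd zs) (x - fst zs))"
    have "(\<integral>\<^sup>+zs. ennreal \<bar>indicator {zs. snd zs < t} zs * ((f x t - f (fst zs) (snd zs)) * Mker \<sigma> (x - fst zs) (t - snd zs))\<bar> \<partial>lborel)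
      \<le> (\<integral>\<^sup>+zs. ?g zs \<partial>lborel)"
    proof (intro nn_integral_mono)
      fix zs :: "(real^'n) \<times> real"
      define z r where "z = fst zs" and "r = t - snd zs"
      consider "r \<le> 0" | "0 < r" "r \<le> 1" | "1 < r" by linarith
      then show "ennreal \<bar>indicator {zs. snd zs < t} zs * ((f x t - f (fst zs) (snd zs)) * Mker \<sigma> (x - fst zs) (t - snd zs))\<bar> \<le> ?g zs"
      proof cases
        case 1
        then show ?thesis by (simp add: r_def)
      next
        case 2
        have "\<bar>f x t - f z (t - r)\<bar> * heatK r (x - z) \<le> (\<bar>H\<bar> * ((norm (x - z))\<^sup>2 + r) powr q) * heatK r (x - z)"
        proof (rule mult_right_mono)
          have "\<bar>f x t - f z (t - r)\<bar> \<le> H * ((norm (x - z))\<^sup>2 + r) powr q"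
            using H[of t "t - r" x z] 2 t by (simp add: q_def)
          also have "\<dots> \<le> \<bar>H\<bar> * ((norm (x - z))\<^sup>2 + r) powr q" by (intro mult_right_mono) auto
          finally show "\<bar>f x t - f z (t - r)\<bar> \<le> \<bar>H\<bar> * ((norm (x - z))\<^sup>2 + r) powr q" .
        qed simp
        also have "\<dots> \<le> \<bar>H\<bar> * (E * r powr q * heatK (2 * r) (x - z))"
          unfolding mult.assoc E_def using parabolic_powr_heatK_le[OF q 2(1), of "x - z"]
          by (intro mult_left_mono) (simp_all add: mult_ac)
        finally have "\<bar>f x t - f z (t - r)\<bar> * heatK r (x - z) * Lker \<sigma> r
          \<le> \<bar>H\<bar> * (E * r powr q * heatK (2 * r) (x - z)) * Lker \<sigma> r"
          by (rule mult_right_mono) (simp add: Lker_def)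
        also have "\<dots> = A1 * (r powr q * r powr (- 1 - \<sigma>)) * heatK (2 * r) (x - z)"
          by (simp add: Lker_def A1_def)
        also have "r powr q * r powr (- 1 - \<sigma>) = r powr (\<epsilon> / 2 - 1)"
          by (subst powr_add[symmetric]) (simp add: q_def field_simps)
        finally have *: "\<bar>f x t - f z (t - r)\<bar> * (heatK r (x - z) * Lker \<sigma> r) \<le> A1 * r powr (\<epsilon> / 2 - 1) * heatK (2 * r) (x - z)"
          by (simp add: mult_ac)
        have "ennreal \<bar>indicator {zs. snd zs < t} zs * ((f x t - f (fst zs) (snd zs)) * Mker \<sigma> (x - fst zs) (t - snd zs))\<bar>
          = ennreal (\<bar>f x t - f z (t - r)\<bar> * (heatK r (x - z) * Lker \<sigma> r))"
          using 2 by (simp add: abs_mult z_def r_def Mker_def Lker_def)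
        also have "\<dots> \<le> ennreal (A1 * r powr (\<epsilon> / 2 - 1) * heatK (2 * r) (x - z))" by (intro ennreal_leI *)
        also have "\<dots> = ?g zs"
          using 2 A by (simp add: z_def r_def ennreal_mult)
        finally show ?thesis .
      next
        case 3
        have "\<bar>f x t - f z (t - r)\<bar> \<le> 2 * B" using B[of t x] B[of "t - r" z] 3 t by auto
        then have "\<bar>f x t - f z (t - r)\<bar> * (heatK r (x - z) * Lker \<sigma> r) \<le> 2 * B * (heatK r (x - z) * Lker \<sigma> r)"
          by (rule mult_right_mono) (simp add: Lker_def)
        also have "\<dots> = A2 * r powr (- 1 - \<sigma>) * heatK r (x - z)" by (simp add: A2_def Lker_def)
        finally have *: "\<bar>f x t - f z (t - r)\<bar> * (heatK r (x - z) * Lker \<sigma> r) \<le> A2 * r powr (- 1 - \<sigma>) * heatK r (x - z)" .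
        have "ennreal \<bar>indicator {zs. snd zs < t} zs * ((f x t - f (fst zs) (snd zs)) * Mker \<sigma> (x - fst zs) (t - snd zs))\<bar>
          = ennreal (\<bar>f x t - f z (t - r)\<bar> * (heatK r (x - z) * Lker \<sigma> r))"
          using 3 by (simp add: abs_mult z_def r_def Mker_def Lker_def)
        also have "\<dots> \<le> ennreal (A2 * r powr (- 1 - \<sigma>) * heatK r (x - z))" by (intro ennreal_leI *)
        also have "\<dots> = ?g zs"
          using 3 A by (simp add: z_def r_def ennreal_mult)
        finally show ?thesis .
      qed
    qed
    also have "\<dots> = (\<integral>\<^sup>+s. \<integral>\<^sup>+z. ?g (z, s) \<partial>lborel \<partial>lborel)"
      by (rule nn_integral_pair_lborel) measurable
    also have "\<dots> = (\<integral>\<^sup>+s. ennreal (A1 * (t - s) powr (\<epsilon> / 2 - 1)) * indicator {0<..1} (t - s)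
      + ennreal (A2 * (t - s) powr (- 1 - \<sigma>)) * indicator {1<..} (t - s) \<partial>lborel)"
    proof (intro nn_integral_cong)
      fix s :: real
      have 1: "(\<integral>\<^sup>+z. ennreal (A1 * (t - s) powr (\<epsilon> / 2 - 1)) * indicator {0<..1} (t - s) * ennreal (heatK (2 * (t - s)) (x - z)) \<partial>lborel)
        = ennreal (A1 * (t - s) powr (\<epsilon> / 2 - 1)) * indicator {0<..1} (t - s)"
        by (subst nn_integral_cmult) (auto simp: nn_integral_heatK' indicator_def)
      have 2: "(\<integral>\<^sup>+z. ennreal (A2 * (t - s) powr (- 1 - \<sigma>)) * indicator {1<..} (t - s) * ennreal (heatK (t - s) (x - z)) \<partial>lborel)
        = ennreal (A2 * (t - s) powr (- 1 - \<sigma>)) * indicator {1<..} (t - s)"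
        by (subst nn_integral_cmult) (auto simp: nn_integral_heatK' indicator_def)
      show "(\<integral>\<^sup>+z. ?g (z, s) \<partial>lborel) = ennreal (A1 * (t - s) powr (\<epsilon> / 2 - 1)) * indicator {0<..1} (t - s)
        + ennreal (A2 * (t - s) powr (- 1 - \<sigma>)) * indicator {1<..} (t - s)"
        unfolding fst_conv snd_conv by (subst nn_integral_add) (measurable, simp only: 1 2)
    qed
    also have "\<dots> = (\<integral>\<^sup>+r. ennreal (A1 * r powr (\<epsilon> / 2 - 1)) * indicator {0<..1} r
      + ennreal (A2 * r powr (- 1 - \<sigma>)) * indicator {1<..} r \<partial>lborel)"
      by (subst nn_integral_real_affine[of _ "-1" t]) auto
    also have "\<dots> \<le> (\<integral>\<^sup>+r. ennreal A1 * (ennreal (r powr (\<epsilon> / 2 - 1)) * indicator {0..1} r)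
      + ennreal A2 * (ennreal (r powr (- 1 - \<sigma>)) * indicator {1..} r) \<partial>lborel)"
      using A by (intro nn_integral_mono) (auto simp: indicator_def ennreal_mult)
    also have "\<dots> = ennreal A1 * ennreal (1 / (\<epsilon> / 2)) + ennreal A2 * ennreal (1 / \<sigma>)"
      using nn_integral_powr_from_0[of "\<epsilon> / 2" 1] nn_integral_powr_to_inf[of "- 1 - \<sigma>"] \<sigma> \<epsilon>
      by (subst nn_integral_add) (simp_all add: nn_integral_cmult)
    also have "\<dots> = ennreal (A1 * (1 / (\<epsilon> / 2)) + A2 * (1 / \<sigma>))"
      using A \<sigma> \<epsilon> by (simp add: ennreal_mult[symmetric] ennreal_plus[symmetric] del: ennreal_plus)
    finally show "(\<integral>\<^sup>+zs. ennreal \<bar>indicator {zs. snd zs < t} zs * ((f x t - f (fst zs) (snd zs)) * Mker \<sigma> (x - fst zs) (t - snd zs))\<bar> \<partial>lborel)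
      \<le> ennreal (A1 * (1 / (\<epsilon> / 2)) + A2 * (1 / \<sigma>))" .
  qed (use A \<sigma> \<epsilon> in auto)
  show thesis
    by (rule that[OF _ bound]) (use A \<sigma> \<epsilon> in auto)
qed

section \<open>Boundedness and measurability of the integral over nonpositive times\<close>

definition datum_part :: "real \<Rightarrow> (real^'n \<Rightarrow> real \<Rightarrow> real) \<Rightarrow> real^'n \<Rightarrow> real \<Rightarrow> real" where
  "datum_part \<sigma> f x t = (LINT zs | lborel. indicator {zs. snd zs \<le> 0} zs *
     (Mop \<sigma> f (fst zs) (snd zs) * Gker \<sigma> (x - fst zs) (t - snd zs)))"

text \<open>Times after \<open>-1\<close> are controlled by the uniform bound on \<open>Mop\<close>.
  Before \<open>-1\<close>, its decay and
  \<open>(t - s) powr (\<sigma> - 1) \<le> (- s) powr (\<sigma> - 1)\<close> leave the exponent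
  \<open>\<sigma> - \<gamma> - 1\<close>, integrable at infinity since
  \<open>\<gamma> > \<sigma>\<close>.\<close>

lemma datum_part_bounded:
  fixes f :: "real^'n \<Rightarrow> real \<Rightarrow> real"
  assumes \<sigma>: "0 < \<sigma>" "\<sigma> < 1" and f: "admissible \<sigma> f" and T: "0 < T"
  obtains C where "0 \<le> C" "\<And>x t. 0 < t \<Longrightarrow> t < T \<Longrightarrow> \<bar>datum_part \<sigma> f x t\<bar> \<le> C"
proof -
  obtain \<epsilon> where "0 < \<epsilon>" "hoelder_p (2 * \<sigma> + \<epsilon>) {(x, t). t \<le> 0} f"
    using f unfolding admissible_def by blast
  then obtain D where D: "0 \<le> D" "\<And>x t. t \<le> 0 \<Longrightarrow> \<bar>Mop \<sigma> f x t\<bar> \<le> D"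
    using Mop_bounded[OF \<sigma>(1)] by metis
  obtain c \<gamma> where \<gamma>: "\<sigma> < \<gamma>" and c: "\<And>x s. s \<le> -1 \<Longrightarrow> \<bar>Mop \<sigma> f x s\<bar> \<le> c * \<bar>s\<bar> powr (- \<gamma>)"
    using f unfolding admissible_def by blast
  have "0 \<le> \<bar>Mop \<sigma> f 0 (-1)\<bar>" by simp
  also have "\<dots> \<le> c" using c[of "-1" 0] by simp
  finally have c0: "0 \<le> c" .
  have G: "0 < Gamma \<sigma>" using \<sigma> by simp
  define C where "C = D * ((T + 1) powr \<sigma> / (\<sigma> * Gamma \<sigma>)) + c / Gamma \<sigma> * (1 / (\<gamma> - \<sigma>))"
  have C0: "0 \<le> C" using D c0 G \<gamma> \<sigma> by (simp add: C_def)
  have "\<bar>datum_part \<sigma> f x t\<bar> \<le> C" if t: "0 < t" "t < T" for x t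
    unfolding datum_part_def
  proof (rule abs_integral_le_nn_integral)
    let ?h = "\<lambda>s::real. ennreal (c * \<bar>s\<bar> powr (- \<gamma>)) * indicator {..-1} s"
    \<comment> \<open>This majorant is left switched on up to time \<open>t\<close>, so that
      \<open>pot_indicator\<close> applies; hence the length \<open>t + 1\<close>.\<close>
    let ?w1 = "\<lambda>zs::(real^'n) \<times> real. ennreal D * indicator {-1..} (snd zs)"
    have main: "(\<integral>\<^sup>+zs. ennreal \<bar>indicator {zs. snd zs \<le> 0} zs * (Mop \<sigma> f (fst zs) (snd zs) * Gker \<sigma> (x - fst zs) (t - snd zs))\<bar> \<partial>lborel)
      \<le> pot \<sigma> (\<lambda>zs. ?w1 zs + ?h (snd zs)) x t"
      unfolding pot_def
    proof (intro nn_integral_mono)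
      fix zs :: "(real^'n) \<times> real"
      let ?M = "\<bar>Mop \<sigma> f (fst zs) (snd zs)\<bar>"
      have "ennreal (indicator {zs. snd zs \<le> 0} zs * ?M) \<le> ?w1 zs + ?h (snd zs)"
      proof -
        consider "0 < snd zs" | "snd zs \<le> 0" "- 1 \<le> snd zs" | "snd zs \<le> - 1" by linarith
        then show ?thesis
        proof cases
          case 2
          then have "ennreal ?M \<le> ennreal D" using D by (intro ennreal_leI) auto
          then show ?thesis using 2 by (auto intro: add_increasing2)
        next
          case 3
          then have "ennreal ?M \<le> ennreal (c * \<bar>snd zs\<bar> powr (- \<gamma>))" using c by (intro ennreal_leI) auto
          then show ?thesis using 3 by (auto intro: add_increasing)
        qed simp
      qed
      then have "ennreal (indicator {zs. snd zs \<le> 0} zs * ?M) * ennreal (Gker \<sigma> (x - fst zs) (t - snd zs))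
        \<le> (?w1 zs + ?h (snd zs)) * ennreal (Gker \<sigma> (x - fst zs) (t - snd zs))"
        by (rule mult_right_mono) simp
      then show "ennreal \<bar>indicator {zs. snd zs \<le> 0} zs * (Mop \<sigma> f (fst zs) (snd zs) * Gker \<sigma> (x - fst zs) (t - snd zs))\<bar>
        \<le> (?w1 zs + ?h (snd zs)) * ennreal (Gker \<sigma> (x - fst zs) (t - snd zs))"
        using \<sigma> by (simp add: abs_mult ennreal_mult[symmetric] mult.assoc)
    qed
    have "pot \<sigma> ?w1 x t = ennreal D * ennreal ((t - (-1)) powr \<sigma> / (\<sigma> * Gamma \<sigma>))"
      using \<sigma> t by (intro pot_indicator) auto
    also have "\<dots> = ennreal (D * ((t + 1) powr \<sigma> / (\<sigma> * Gamma \<sigma>)))"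
      using D \<sigma> G by (simp add: ennreal_mult[symmetric])
    also have "\<dots> \<le> ennreal (D * ((T + 1) powr \<sigma> / (\<sigma> * Gamma \<sigma>)))"
      using t D \<sigma> G by (intro ennreal_leI mult_left_mono divide_right_mono powr_mono2) auto
    finally have recent: "pot \<sigma> ?w1 x t \<le> ennreal (D * ((T + 1) powr \<sigma> / (\<sigma> * Gamma \<sigma>)))" .
    have "pot \<sigma> (\<lambda>zs. ?h (snd zs)) x t
        = (\<integral>\<^sup>+s. ?h s * (ennreal ((t - s) powr (\<sigma> - 1) / Gamma \<sigma>) * indicator {..<t} s) \<partial>lborel)"
      using \<sigma> by (intro pot_time) auto
    also have "\<dots> \<le> (\<integral>\<^sup>+s. ennreal (c / Gamma \<sigma>) * (ennreal ((- s) powr (\<sigma> - \<gamma> - 1)) * indicator {1..} (- s)) \<partial>lborel)"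
    proof (intro nn_integral_mono)
      fix s :: real
      show "?h s * (ennreal ((t - s) powr (\<sigma> - 1) / Gamma \<sigma>) * indicator {..<t} s)
        \<le> ennreal (c / Gamma \<sigma>) * (ennreal ((- s) powr (\<sigma> - \<gamma> - 1)) * indicator {1..} (- s))"
      proof (cases "s \<le> - 1")
        case True
        have "(t - s) powr (\<sigma> - 1) \<le> (- s) powr (\<sigma> - 1)"
          using True t \<sigma> by (intro powr_mono2') auto
        then have "c * (- s) powr (- \<gamma>) * ((t - s) powr (\<sigma> - 1) / Gamma \<sigma>) \<le> c * (- s) powr (- \<gamma>) * ((- s) powr (\<sigma> - 1) / Gamma \<sigma>)"
          using c0 G by (intro mult_left_mono divide_right_mono) auto
        also have "\<dots> = c / Gamma \<sigma> * ((- s) powr (- \<gamma>) * (- s) powr (\<sigma> - 1))" by simp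
        also have "(- s) powr (- \<gamma>) * (- s) powr (\<sigma> - 1) = (- s) powr (\<sigma> - \<gamma> - 1)"
          by (subst powr_add[symmetric]) (simp add: algebra_simps)
        finally have "ennreal (c * (- s) powr (- \<gamma>) * ((t - s) powr (\<sigma> - 1) / Gamma \<sigma>)) \<le> ennreal (c / Gamma \<sigma> * (- s) powr (\<sigma> - \<gamma> - 1))"
          by (rule ennreal_leI)
        then show ?thesis using True t c0 \<sigma> by (simp add: ennreal_mult[symmetric])
      qed simp
    qed
    also have "\<dots> = (\<integral>\<^sup>+s. ennreal (c / Gamma \<sigma>) * (ennreal (s powr (\<sigma> - \<gamma> - 1)) * indicator {1..} s) \<partial>lborel)"
      by (subst nn_integral_real_affine[of _ "-1" 0]) auto
    also have "\<dots> = ennreal (c / Gamma \<sigma>) * ennreal (1 / (\<gamma> - \<sigma>))"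
      using nn_integral_powr_to_inf[of "\<sigma> - \<gamma> - 1"] \<gamma> by (subst nn_integral_cmult) (simp_all add: minus_divide_right)
    finally have remote: "pot \<sigma> (\<lambda>zs. ?h (snd zs)) x t \<le> ennreal (c / Gamma \<sigma>) * ennreal (1 / (\<gamma> - \<sigma>))" .
    note main
    also have "pot \<sigma> (\<lambda>zs. ?w1 zs + ?h (snd zs)) x t = pot \<sigma> ?w1 x t + pot \<sigma> (\<lambda>zs. ?h (snd zs)) x t"
      by (rule pot_add) measurable
    also have "\<dots> \<le> ennreal (D * ((T + 1) powr \<sigma> / (\<sigma> * Gamma \<sigma>))) + ennreal (c / Gamma \<sigma>) * ennreal (1 / (\<gamma> - \<sigma>))"
      by (intro add_mono recent remote)
    also have "\<dots> = ennreal C"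
      using D c0 G \<sigma> \<gamma> by (simp add: C_def ennreal_mult[symmetric] ennreal_plus[symmetric] del: ennreal_plus)
    finally show "(\<integral>\<^sup>+zs. ennreal \<bar>indicator {zs. snd zs \<le> 0} zs * (Mop \<sigma> f (fst zs) (snd zs) * Gker \<sigma> (x - fst zs) (t - snd zs))\<bar> \<partial>lborel) \<le> ennreal C" .
  qed (rule C0)
  then show thesis using that C0 by blast
qed

text \<open>If the integrand is not measurable then every Bochner integral in question is \<open>0\<close>.\<close>

lemma datum_part_measurable:
  fixes f :: "real^'n \<Rightarrow> real \<Rightarrow> real"
  assumes \<sigma>: "0 < \<sigma>"
  obtains F :: "(real^'n) \<times> real \<Rightarrow> real" where "F \<in> borel_measurable borel"
    "\<And>x t. 0 < t \<Longrightarrow> datum_part \<sigma> f x t = F (x, t)"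
proof -
  define g where "g = (\<lambda>zs::(real^'n) \<times> real. indicator {zs. snd zs \<le> 0} zs * Mop \<sigma> f (fst zs) (snd zs))"
  have eq: "datum_part \<sigma> f x t = (LINT zs | lborel. g zs * Gker \<sigma> (x - fst zs) (t - snd zs))" for x t
    by (simp add: datum_part_def g_def mult.assoc)
  show thesis
  proof (cases "g \<in> borel_measurable borel")
    case True
    note [measurable] = True
    have [measurable]: "(\<lambda>q::((real^'n) \<times> real) \<times> (real^'n) \<times> real. snd q) \<in> borel_measurable (borel \<Otimes>\<^sub>M lborel)"
      "(\<lambda>q::((real^'n) \<times> real) \<times> (real^'n) \<times> real. g (snd q)) \<in> borel_measurable (borel \<Otimes>\<^sub>M lborel)"
      by measurable
    have "(\<lambda>xt. LINT zs | lborel. g zs * Gker \<sigma> (fst xt - fst zs) (snd xt - snd zs)) \<in> borel_measurable borel"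
      by measurable
    then show thesis by (rule that) (simp add: eq)
  next
    case False
    have "datum_part \<sigma> f x t = 0" if t: "0 < t" for x t
      unfolding eq
    proof (rule not_integrable_integral_eq, rule)
      assume "integrable lborel (\<lambda>zs. g zs * Gker \<sigma> (x - fst zs) (t - snd zs))"
      then have [measurable]: "(\<lambda>zs. g zs * Gker \<sigma> (x - fst zs) (t - snd zs)) \<in> borel_measurable borel"
        using borel_measurable_integrable by fastforce
      \<comment> \<open>The kernel is positive where \<open>g\<close> can be nonzero, so dividing by
        it recovers \<open>g\<close> from the integrand.\<close>
      have "(\<lambda>zs. (g zs * Gker \<sigma> (x - fst zs) (t - snd zs)) / Gker \<sigma> (x - fst zs) (t - snd zs)) \<in> borel_measurable borel"
        by measurable
      also have "(\<lambda>zs. (g zs * Gker \<sigma> (x - fst zs) (t - snd zs)) / Gker \<sigma> (x - fst zs) (t - snd zs)) = g"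
      proof
        fix zs :: "(real^'n) \<times> real"
        show "(g zs * Gker \<sigma> (x - fst zs) (t - snd zs)) / Gker \<sigma> (x - fst zs) (t - snd zs) = g zs"
          using Gker_pos[OF \<sigma>, of "t - snd zs" "x - fst zs"] t by (cases "snd zs \<le> 0") (auto simp: g_def)
      qed
      finally show False using False by simp
    qed
    then show thesis by (intro that[of "\<lambda>_. 0"]) auto
  qed
qed

section \<open>Measurability of the solution\<close>

definition memory_part :: "real \<Rightarrow> real \<Rightarrow> (real^'n \<Rightarrow> real \<Rightarrow> real) \<Rightarrow> real^'n \<Rightarrow> real \<Rightarrow> real" where
  "memory_part \<sigma> p u x t = (LINT zs | lborel. indicator {zs. 0 < snd zs \<and> snd zs < t} zs *
     ((u (fst zs) (snd zs)) powr p * Gker \<sigma> (x - fst zs) (t - snd zs)))"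

text \<open>Measurability of \<open>u\<close> is not part of \<open>is_solution\<close>. Beyond the last time up to which \<open>u\<close> is
  measurable the integral of \<open>u\<^sup>p\<close> would be \<open>0\<close> by convention, so \<open>u\<close> would coincide with the
  (measurable) contribution of the datum.\<close>

lemma solution_measurable:
  fixes u :: "real^'n \<Rightarrow> real \<Rightarrow> real"
  assumes \<sigma>: "0 < \<sigma>" and p: "0 < p" and T: "0 < T" and sol: "is_solution \<sigma> p f T u"
  shows "(\<lambda>zs. indicator {0<..<T} (snd zs) * u (fst zs) (snd zs)) \<in> borel_measurable borel"
proof -
  define V where "V = (\<lambda>\<tau> zs. indicator {0<..<\<tau>} (snd zs) * u (fst zs) (snd zs))"
  have nonneg: "0 \<le> u x t" if "t < T" for x t
    using sol that unfolding is_solution_def by blast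
  have u_eq: "u x t = datum_part \<sigma> f x t + memory_part \<sigma> p u x t" if "0 < t" "t < T" for x t
    using sol that unfolding is_solution_def datum_part_def memory_part_def by blast
  obtain F :: "(real^'n) \<times> real \<Rightarrow> real" where [measurable]: "F \<in> borel_measurable borel"
    and F: "\<And>x t. 0 < t \<Longrightarrow> datum_part \<sigma> f x t = F (x, t)"
    using datum_part_measurable[OF \<sigma>] by blast
  have mem0: "memory_part \<sigma> p u x t = 0" if t: "0 < t" "t < T" and nm: "V t \<notin> borel_measurable borel" for x t
    unfolding memory_part_def
  proof (rule not_integrable_integral_eq, rule)
    let ?i = "\<lambda>zs. indicator {zs. 0 < snd zs \<and> snd zs < t} zs * ((u (fst zs) (snd zs)) powr p * Gker \<sigma> (x - fst zs) (t - snd zs))"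
    assume "integrable lborel ?i"
    then have [measurable]: "?i \<in> borel_measurable borel"
      using borel_measurable_integrable by fastforce
    \<comment> \<open>Division by the positive kernel and the \<open>p\<close>-th root recover
      \<open>V t\<close>; outside the range of times both sides are \<open>0\<close>.\<close>
    have "(\<lambda>zs. (?i zs / Gker \<sigma> (x - fst zs) (t - snd zs)) powr (1 / p)) \<in> borel_measurable borel"
      by measurable
    also have "(\<lambda>zs. (?i zs / Gker \<sigma> (x - fst zs) (t - snd zs)) powr (1 / p)) = V t"
    proof
      fix zs :: "(real^'n) \<times> real"
      show "(?i zs / Gker \<sigma> (x - fst zs) (t - snd zs)) powr (1 / p) = V t zs"
        using Gker_pos[OF \<sigma>, of "t - snd zs" "x - fst zs"] t p nonneg[of "snd zs" "fst zs"]
        by (cases "0 < snd zs \<and> snd zs < t") (auto simp: V_def powr_powr indicator_def)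
    qed
    finally show False using nm by simp
  qed
  define E where "E = {t. 0 \<le> t \<and> t \<le> T \<and> V t \<in> borel_measurable borel}"
  define ts where "ts = Sup E"
  have "V 0 = (\<lambda>_. 0)" by (auto simp: V_def)
  then have E0: "0 \<in> E" using T by (simp add: E_def)
  have bdd: "bdd_above E" by (auto simp: E_def intro!: bdd_aboveI[of _ T])
  \<comment> \<open>The supremum of \<open>E\<close> is itself a time of measurability, because
    \<open>V ts\<close> is a pointwise limit of functions \<open>V (a n)\<close> with
    \<open>a n\<close> in \<open>E\<close>.\<close>
  have Vts [measurable]: "V ts \<in> borel_measurable borel"
  proof -
    have "\<exists>t\<in>E. ts - 1 / Suc n < t" for n
      using less_cSup_iff[OF _ bdd, of "ts - 1 / Suc n"] E0 by (auto simp: ts_def)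
    then obtain a where a: "\<And>n. a n \<in> E" "\<And>n. ts - 1 / Suc n < a n" by metis
    have a_le: "a n \<le> ts" for n unfolding ts_def using a(1) bdd by (rule cSup_upper)
    have "(\<lambda>n. ts - 1 / Suc n) \<longlonglongrightarrow> ts - 0"
      by (intro tendsto_intros LIMSEQ_Suc[OF lim_1_over_n])
    then have lim: "(\<lambda>n. ts - 1 / Suc n) \<longlonglongrightarrow> ts" by simp
    show ?thesis
    proof (rule borel_measurable_LIMSEQ_real[where u="\<lambda>n. V (a n)"])
      show "V (a n) \<in> borel_measurable borel" for n using a(1) by (auto simp: E_def)
      show "(\<lambda>n. V (a n) zs) \<longlonglongrightarrow> V ts zs" for zs
      proof (cases "snd zs < ts")
        case True
        have "\<forall>\<^sub>F n in sequentially. snd zs < ts - 1 / Suc n"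
          by (rule order_tendstoD(1)[OF lim True])
        then have "\<forall>\<^sub>F n in sequentially. V (a n) zs = V ts zs"
        proof eventually_elim
          case (elim n)
          then show ?case using a(2)[of n] True by (auto simp: V_def indicator_def)
        qed
        then show ?thesis by (rule tendsto_eventually)
      next
        case False
        then have "V (a n) zs = V ts zs" for n using a_le[of n] by (auto simp: V_def indicator_def)
        then show ?thesis by simp
      qed
    qed
  qed
  define W where "W = (\<lambda>xt. LINT zs | lborel. V ts zs powr p * Gker \<sigma> (fst xt - fst zs) (snd xt - snd zs))"
  have [measurable]: "W \<in> borel_measurable borel"
  proof -
    have [measurable]: "(\<lambda>q::((real^'n) \<times> real) \<times> (real^'n) \<times> real. snd q) \<in> borel_measurable (borel \<Otimes>\<^sub>M lborel)"
      "(\<lambda>q::((real^'n) \<times> real) \<times> (real^'n) \<times> real. V ts (snd q)) \<in> borel_measurable (borel \<Otimes>\<^sub>M lborel)"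
      by measurable
    show ?thesis unfolding W_def by measurable
  qed
  \<comment> \<open>Up to \<open>ts\<close> the memory integral only involves \<open>V ts\<close>,
    as the kernel vanishes for future sources; after \<open>ts\<close> it is \<open>0\<close> by
    \<open>mem0\<close>. Both pieces are measurable.\<close>
  have "V T = (\<lambda>xt. indicator {0<..<T} (snd xt) * (F xt + indicator {..ts} (snd xt) * W xt))"
  proof
    fix xt :: "(real^'n) \<times> real"
    obtain x t where xt: "xt = (x, t)" by (cases xt)
    show "V T xt = indicator {0<..<T} (snd xt) * (F xt + indicator {..ts} (snd xt) * W xt)"
    proof (cases "0 < t \<and> t < T")
      case t: True
      have "memory_part \<sigma> p u x t = indicator {..ts} t * W (x, t)"
      proof (cases "t \<le> ts")
        case True
        have "indicator {zs. 0 < snd zs \<and> snd zs < t} zs * ((u (fst zs) (snd zs)) powr p * Gker \<sigma> (x - fst zs) (t - snd zs))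
          = V ts zs powr p * Gker \<sigma> (x - fst zs) (t - snd zs)" for zs
          using True by (cases "snd zs < t") (auto simp: V_def indicator_def Gker_eq_0)
        then have "memory_part \<sigma> p u x t = W (x, t)"
          unfolding memory_part_def W_def by (simp only: fst_conv snd_conv)
        then show ?thesis using True by simp
      next
        case False
        have "t \<notin> E"
        proof
          assume "t \<in> E"
          then have "t \<le> ts" unfolding ts_def by (rule cSup_upper[OF _ bdd])
          then show False using False by simp
        qed
        then have "V t \<notin> borel_measurable borel" using t by (auto simp: E_def)
        then show ?thesis using mem0 t False by simp
      qed
      then show ?thesis using u_eq[of t x] F[of t x] t by (simp add: V_def xt)
    qed (auto simp: V_def xt indicator_def)
  qed
  also have "\<dots> \<in> borel_measurable borel" by measurable
  finally show ?thesis by (simp add: V_def)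
qed

section \<open>Reduction of the original problem to \<open>mild_solution\<close>\<close>

text \<open>Boundedness up to \<open>t < T\<close> makes the memory integrand integrable, so its
  Bochner integral agrees with the \<open>ennreal\<close> potential. The bound \<open>C\<close> on
  the datum part then gives both comparisons.\<close>

lemma mild_solution_of_is_solution:
  fixes u f :: "real^'n \<Rightarrow> real \<Rightarrow> real"
  assumes \<sigma>: "0 < \<sigma>" "\<sigma> < 1" and p: "1 < p" and T: "0 < T"
    and adm: "admissible \<sigma> f" and sol: "is_solution \<sigma> p f T u"
  obtains C where "mild_solution \<sigma> p T C (\<lambda>zs. indicator {0<..<T} (snd zs) * u (fst zs) (snd zs))"
proof -
  define U where "U = (\<lambda>zs. indicator {0<..<T} (snd zs) * u (fst zs) (snd zs))"
  obtain C where C: "0 \<le> C" "\<And>x t. 0 < t \<Longrightarrow> t < T \<Longrightarrow> \<bar>datum_part \<sigma> f x t\<bar> \<le> C"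
    using datum_part_bounded[OF \<sigma> adm T] by blast
  have nonneg: "0 \<le> u x t" if "t < T" for x t
    using sol that unfolding is_solution_def by blast
  have u_eq: "u x t = datum_part \<sigma> f x t + memory_part \<sigma> p u x t" if "0 < t" "t < T" for x t
    using sol that unfolding is_solution_def datum_part_def memory_part_def by blast
  have meas [measurable]: "U \<in> borel_measurable borel"
    unfolding U_def using \<sigma> p T sol by (intro solution_measurable) auto
  have U_nonneg: "0 \<le> U zs" for zs
    using nonneg by (auto simp: U_def indicator_def)
  have bdd: "\<exists>B. \<forall>z s. s \<le> t \<longrightarrow> U (z, s) \<le> B" if "t < T" for t
  proof -
    have "\<exists>B. \<forall>x s. s \<le> t \<longrightarrow> \<bar>u x s\<bar> \<le> B"
      using sol that unfolding is_solution_def by blast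
    then obtain B where B: "\<And>x s. s \<le> t \<Longrightarrow> \<bar>u x s\<bar> \<le> B" by blast
    have "U (z, s) \<le> B" if "s \<le> t" for z s
      using B[OF that, of z] by (auto simp: U_def indicator_def)
    then show ?thesis by blast
  qed
  have pot: "pot \<sigma> (\<lambda>zs. ennreal (U zs powr p)) x t = ennreal (memory_part \<sigma> p u x t)" "0 \<le> memory_part \<sigma> p u x t"
    if t: "0 < t" "t < T" for x t
  proof -
    let ?i = "\<lambda>zs. U zs powr p * Gker \<sigma> (x - fst zs) (t - snd zs)"
    have i_eq: "indicator {zs. 0 < snd zs \<and> snd zs < t} zs * ((u (fst zs) (snd zs)) powr p * Gker \<sigma> (x - fst zs) (t - snd zs))
      = ?i zs" for zs
      using t by (cases "snd zs < t") (auto simp: U_def indicator_def Gker_eq_0)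
    have i0: "0 \<le> ?i zs" for zs using \<sigma> by simp
    obtain B where B: "\<And>z s. s \<le> t \<Longrightarrow> U (z, s) \<le> B" using bdd[OF t(2)] by blast
    have "pot \<sigma> (\<lambda>zs. ennreal (U zs powr p)) x t \<le> pot \<sigma> (\<lambda>zs. ennreal (B powr p) * indicator {0..} (snd zs)) x t"
    proof (rule pot_mono)
      fix z :: "real^'n" and s assume "s < t"
      then show "ennreal (U (z, s) powr p) \<le> ennreal (B powr p) * indicator {0..} (snd (z, s))"
        using B[of s z] U_nonneg[of "(z, s)"] p
        by (cases "0 \<le> s") (auto intro!: ennreal_leI powr_mono2 simp: U_def)
    qed (rule \<sigma>)
    also have "\<dots> < top"
      using \<sigma> t by (subst pot_indicator) (auto simp: ennreal_mult_less_top)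
    finally have fin: "(\<integral>\<^sup>+zs. ennreal (?i zs) \<partial>lborel) < top"
      using \<sigma> by (simp add: pot_def ennreal_mult)
    then have "integrable lborel ?i"
      using i0 by (intro integrableI_nonneg) auto
    then show "pot \<sigma> (\<lambda>zs. ennreal (U zs powr p)) x t = ennreal (memory_part \<sigma> p u x t)"
      using nn_integral_eq_integral[of lborel ?i] i0 \<sigma>
      by (simp add: pot_def memory_part_def i_eq ennreal_mult)
    show "0 \<le> memory_part \<sigma> p u x t"
      unfolding memory_part_def i_eq using i0 by (intro integral_nonneg_AE) auto
  qed
  have "mild_solution \<sigma> p T C U"
  proof
    show "U (z, s) = 0" if "s \<le> 0" for z s using that by (simp add: U_def)
    fix x :: "real^'n" and t assume t: "0 < t" "t < T"
    have U: "U (x, t) = u x t" using t by (simp add: U_def)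
    have "ennreal (U (x, t)) \<le> ennreal (memory_part \<sigma> p u x t + C)"
      unfolding U using u_eq[OF t, of x] C(2)[OF t, of x] by (intro ennreal_leI) auto
    then show "ennreal (U (x, t)) \<le> pot \<sigma> (\<lambda>zs. ennreal (U zs powr p)) x t + ennreal C"
      using pot[OF t] C(1) by simp
    show "pot \<sigma> (\<lambda>zs. ennreal (U zs powr p)) x t \<le> ennreal (U (x, t) + C)"
      unfolding pot(1)[OF t] U using u_eq[OF t, of x] C(2)[OF t, of x] by (intro ennreal_leI) auto
  qed (use \<sigma> p T C bdd U_nonneg in auto)
  then show thesis unfolding U_def by (rule that)
qed

theorem theorem1p2:
  fixes f u :: "real^'n \<Rightarrow> real \<Rightarrow> real"
    and \<sigma> p T :: real
  assumes sigma: "0 < \<sigma>" "\<sigma> < 1"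
    and p: "1 < p" "p \<le> 1 + 2 * \<sigma> / (real CARD('n) + 2 * (1 - \<sigma>))"
    and adm: "admissible \<sigma> f"
    and nontriv: "\<exists>x t. t \<le> 0 \<and> f x t \<noteq> 0"
    and T: "0 < T"
    and sol: "is_solution \<sigma> p f T u"
    and blowup: "filterlim (supnorm u) at_top (at_left T)"
  shows "\<exists>c1 c2. 0 < c1 \<and> c1 \<le> c2 \<and>
    (\<forall>\<^sub>F t in at_left T.
        c1 * (T - t) powr (- \<sigma> / (p - 1)) \<le> supnorm u t \<and>
        supnorm u t \<le> c2 * (T - t) powr (- \<sigma> / (p - 1)))"
proof -
  define U where "U = (\<lambda>zs. indicator {0<..<T} (snd zs) * u (fst zs) (snd zs))"
  obtain C where "mild_solution \<sigma> p T C U"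
    using mild_solution_of_is_solution[OF sigma p(1) T adm sol] unfolding U_def by blast
  then interpret M: mild_solution \<sigma> p T C U .
  have nn: "0 \<le> u x t" if "t < T" for x t
    using sol that unfolding is_solution_def by blast
  have "\<forall>\<^sub>F t in at_left T. 0 < t \<and> t < T"
    using eventually_at_left[OF T] T by auto
  \<comment> \<open>Close to \<open>T\<close> the cut-off is inactive and nonnegativity removes the
    absolute value, so the rate for \<open>U\<close> transfers to \<open>u\<close>.\<close>
  then have eq: "\<forall>\<^sub>F t in at_left T. supnorm u t = (SUP x. U (x, t))"
    by eventually_elim (simp add: supnorm_def U_def nn)
  have "filterlim (\<lambda>t. SUP x. U (x, t)) at_top (at_left T)"
    using filterlim_cong[OF refl refl eq] blowup by simp
  from M.blowup_rate[OF p(2) this] obtain c1 c2 where c: "0 < c1" "c1 \<le> c2"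
    and rate: "\<forall>\<^sub>F t in at_left T. c1 * (T - t) powr (- \<sigma> / (p - 1)) \<le> (SUP x. U (x, t)) \<and>
      (SUP x. U (x, t)) \<le> c2 * (T - t) powr (- \<sigma> / (p - 1))"
    by blast
  have "\<forall>\<^sub>F t in at_left T. c1 * (T - t) powr (- \<sigma> / (p - 1)) \<le> supnorm u t \<and>
      supnorm u t \<le> c2 * (T - t) powr (- \<sigma> / (p - 1))"
    using rate eq by eventually_elim simp
  then show ?thesis using c by blast
qed

end
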